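(* Let $1\le p\le\infty$ and $1/p+1/p'=1$. If $(n_i)_{i\in I}$ is a family of positive integers, then $\big(\sum_{i\in I}\min_p(\ell^{p'}_{n_i})\big)_1$ is $1$-projective as a $p$-multinormed space.
   Context: All spaces are over the real field; $\mathbb{N}=\{1,2,\dots\}$. For $1\le p\le\infty$, a $p$-multinormed space is a Banach space $X$ together with, for each $n\in\mathbb{N}$, a norm $\|\cdot\|_n$ (written $\|\cdot\|$) on $\ell^p_n\otimes X$ such that: (1) $\|a\otimes x\|_n=\|a\|\,\|x\|$ for $a\in\ell^p_n$, $x\in X$; (2) $\|w\|_n\ge|\langle a^*\otimes x^*,w\rangle|$ for all $w\in\ell^p_n\otimes X$ and all $a^*\in(\ell^p_n)^*$, $x^*\in X^*$ of norm at most $1$; (3) $\|(T\otimes I_X)w\|_m\le\|T\|\,\|w\|_n$ for all $m,n$, all $T\in B(\ell^p_n,\ell^p_m)$ and all $w\in\ell^p_n\otimes X$. (This is equivalent to giving a left tensorial cross-norm on $\ell^p\otimes X$, or on $c_0\otimes X$ if $p=\infty$.) For a linear map $u:X\to Y$ between $p$-multinormed spaces, $\|u\|_p=\sup_n\|I_{\ell^p_n}\otimes u:\ell^p_n\otimes X\to\ell^p_n\otimes Y\|$; $u$ is $p$-multibounded if $\|u\|_p<\infty$. A linear map $q:Y\to X$ is a $p$-quotient map if for every $n$ the map $I_{\ell^p_n}\otimes q:\ell^p_n\otimes Y\to\ell^p_n\otimes X$ is a quotient map (it maps the open unit ball onto the open unit ball). For a Banach space $E$, $\min_p(E)$ is the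 $p$-multinormed space in which $\ell^p_n\otimes E$ carries the Banach space injective tensor norm. The $\ell^1$ sum $(\sum_iX_i)_1$ of $p$-multinormed spaces has the Banach space $\ell^1$ sum as its underlying Banach space; an element of its tensor product with $\ell^p_n$ is a family $x=(x_i)$, $x_i\in\ell^p_n\otimes X_i$, and $\|x\|_n=\sum_i\|x_i\|_{\ell^p_n\otimes X_i}$. A $p$-multinormed space $Z$ is $1$-projective if for every $\varepsilon>0$, every $p$-quotient map $q:Y\to X$ between $p$-multinormed spaces, and every $p$-multibounded $u:Z\to X$, there exists $\tilde u:Z\to Y$ with $\|\tilde u\|_p\le\|u\|_p+\varepsilon$ and $q\tilde u=u$. *)

theory Defs
  imports "HOL-Analysis.Analysis" "HOL-Library.Function_Algebras"
begin

instantiation "fun" :: (type, real_vector) real_vector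
begin

definition scaleR_fun :: "real \<Rightarrow> ('a \<Rightarrow> 'b) \<Rightarrow> 'a \<Rightarrow> 'b" where
  "scaleR_fun c f = (\<lambda>x. c *\<^sub>R f x)"

instance
  by standard (simp_all add: scaleR_fun_def fun_eq_iff algebra_simps)

end

(* A normed space is a linear subspace of an ambient real vector space together with a norm that
   is meaningful only on that subspace.  Carriers are needed because l^p_n and the l^1 sum depend
   on parameters, so they cannot be types. *)

record 'a nspace =
  carr :: "'a set"
  nrm :: "'a \<Rightarrow> real"

definition normed_space :: "('a::real_vector, 'm) nspace_scheme \<Rightarrow> bool" where
  "normed_space E \<longleftrightarrow>
     subspace (carr E) \<and>
     (\<forall>x\<in>carr E. 0 \<le> nrm E x \<and> (nrm E x = 0 \<longleftrightarrow> x = 0)) \<and>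
     (\<forall>c. \<forall>x\<in>carr E. nrm E (c *\<^sub>R x) = \<bar>c\<bar> * nrm E x) \<and>
     (\<forall>x\<in>carr E. \<forall>y\<in>carr E. nrm E (x + y) \<le> nrm E x + nrm E y)"

definition banach_space :: "('a::real_vector, 'm) nspace_scheme \<Rightarrow> bool" where
  "banach_space E \<longleftrightarrow>
     normed_space E \<and>
     (\<forall>s::nat \<Rightarrow> 'a.
        range s \<subseteq> carr E \<longrightarrow>
        (\<forall>e>0. \<exists>N. \<forall>i\<ge>N. \<forall>j\<ge>N. nrm E (s i - s j) < e) \<longrightarrow>
        (\<exists>x\<in>carr E. (\<lambda>i. nrm E (s i - x)) \<longlonglongrightarrow> 0))"

definition linear_map ::
  "('a::real_vector, 'm) nspace_scheme \<Rightarrow> ('b::real_vector, 'k) nspace_scheme \<Rightarrow> ('a \<Rightarrow> 'b) \<Rightarrow> bool"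
where
  "linear_map E F u \<longleftrightarrow>
     u ` carr E \<subseteq> carr F \<and>
     (\<forall>x\<in>carr E. \<forall>y\<in>carr E. u (x + y) = u x + u y) \<and>
     (\<forall>c. \<forall>x\<in>carr E. u (c *\<^sub>R x) = c *\<^sub>R u x)"

definition op_norm ::
  "('a::real_vector, 'm) nspace_scheme \<Rightarrow> ('b::real_vector, 'k) nspace_scheme \<Rightarrow> ('a \<Rightarrow> 'b) \<Rightarrow> ennreal"
where
  "op_norm E F u = (SUP x\<in>{x\<in>carr E. nrm E x \<le> 1}. ennreal (nrm F (u x)))"

definition bounded_maps ::
  "('a::real_vector, 'm) nspace_scheme \<Rightarrow> ('b::real_vector, 'k) nspace_scheme \<Rightarrow> ('a \<Rightarrow> 'b) set"
where
  "bounded_maps E F = {u. linear_map E F u \<and> op_norm E F u < \<infinity>}"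

definition scalars :: "real nspace" where
  "scalars = \<lparr>carr = UNIV, nrm = abs\<rparr>"

definition dual_ball :: "('a::real_vector, 'm) nspace_scheme \<Rightarrow> ('a \<Rightarrow> real) set" where
  "dual_ball E = {f \<in> bounded_maps E scalars. op_norm E scalars f \<le> 1}"

(* Vectors of l^p_n are functions on nat vanishing from n on. *)

definition ellp :: "ennreal \<Rightarrow> nat \<Rightarrow> (nat \<Rightarrow> real) nspace" where
  "ellp p n = \<lparr>
     carr = {a. \<forall>i\<ge>n. a i = 0},
     nrm = (\<lambda>a. if p = \<infinity> then Max ((\<lambda>i. \<bar>a i\<bar>) ` {..<n})
                else (\<Sum>i<n. \<bar>a i\<bar> powr enn2real p) powr (1 / enn2real p))\<rparr>"

definition unit_vec :: "nat \<Rightarrow> nat \<Rightarrow> real" where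
  "unit_vec k = (\<lambda>i. if i = k then 1 else 0)"

(* The tensor product of l^p_n with X is realised as X^n: the tuple w, extended by 0, stands for
   the sum over k < n of (unit_vec k) \<otimes> (w k). *)

definition tensor_carr :: "nat \<Rightarrow> ('a::real_vector, 'm) nspace_scheme \<Rightarrow> (nat \<Rightarrow> 'a) set" where
  "tensor_carr n X = {w. (\<forall>k<n. w k \<in> carr X) \<and> (\<forall>k\<ge>n. w k = 0)}"

definition elem_tensor :: "(nat \<Rightarrow> real) \<Rightarrow> 'a::real_vector \<Rightarrow> nat \<Rightarrow> 'a" where
  "elem_tensor a x = (\<lambda>k. a k *\<^sub>R x)"

definition tensor_pairing ::
  "nat \<Rightarrow> ((nat \<Rightarrow> real) \<Rightarrow> real) \<Rightarrow> ('a \<Rightarrow> real) \<Rightarrow> (nat \<Rightarrow> 'a) \<Rightarrow> real" where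
  "tensor_pairing n a f w = (\<Sum>k<n. a (unit_vec k) * f (w k))"

definition tensor_left ::
  "nat \<Rightarrow> ((nat \<Rightarrow> real) \<Rightarrow> nat \<Rightarrow> real) \<Rightarrow> (nat \<Rightarrow> 'a::real_vector) \<Rightarrow> nat \<Rightarrow> 'a" where
  "tensor_left n T w = (\<Sum>k<n. elem_tensor (T (unit_vec k)) (w k))"

(* Since a linear u maps 0 to 0, this also preserves the extension of tuples by 0. *)

definition tensor_right :: "('a \<Rightarrow> 'b) \<Rightarrow> (nat \<Rightarrow> 'a) \<Rightarrow> nat \<Rightarrow> 'b" where
  "tensor_right u w = (\<lambda>k. u (w k))"

record 'a mnspace = "'a nspace" +
  tnrm :: "nat \<Rightarrow> (nat \<Rightarrow> 'a) \<Rightarrow> real"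

definition tensor_space :: "nat \<Rightarrow> 'a::real_vector mnspace \<Rightarrow> (nat \<Rightarrow> 'a) nspace" where
  "tensor_space n X = \<lparr>carr = tensor_carr n X, nrm = tnrm X n\<rparr>"

definition multinormed_space :: "ennreal \<Rightarrow> 'a::real_vector mnspace \<Rightarrow> bool" where
  "multinormed_space p X \<longleftrightarrow>
     banach_space X \<and>
     (\<forall>n\<ge>1. normed_space (tensor_space n X)) \<and>
     (\<forall>n\<ge>1. \<forall>a\<in>carr (ellp p n). \<forall>x\<in>carr X.
        nrm (tensor_space n X) (elem_tensor a x) = nrm (ellp p n) a * nrm X x) \<and>
     (\<forall>n\<ge>1. \<forall>w\<in>carr (tensor_space n X). \<forall>a\<in>dual_ball (ellp p n). \<forall>f\<in>dual_ball X.
        \<bar>tensor_pairing n a f w\<bar> \<le> nrm (tensor_space n X) w) \<and>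
     (\<forall>m\<ge>1. \<forall>n\<ge>1. \<forall>T\<in>bounded_maps (ellp p n) (ellp p m). \<forall>w\<in>carr (tensor_space n X).
        ennreal (nrm (tensor_space m X) (tensor_left n T w))
          \<le> op_norm (ellp p n) (ellp p m) T * ennreal (nrm (tensor_space n X) w))"

(* The exponent p enters the multibound and the notion of quotient map only through the
   multinorms of the two spaces. *)

definition multibound ::
  "'a::real_vector mnspace \<Rightarrow> 'b::real_vector mnspace \<Rightarrow> ('a \<Rightarrow> 'b) \<Rightarrow> ennreal" where
  "multibound X Y u = (SUP n\<in>{1..}. op_norm (tensor_space n X) (tensor_space n Y) (tensor_right u))"

definition multibounded ::
  "'a::real_vector mnspace \<Rightarrow> 'b::real_vector mnspace \<Rightarrow> ('a \<Rightarrow> 'b) \<Rightarrow> bool" where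
  "multibounded X Y u \<longleftrightarrow> linear_map X Y u \<and> multibound X Y u < \<infinity>"

definition open_ball :: "('a, 'm) nspace_scheme \<Rightarrow> 'a set" where
  "open_ball E = {x\<in>carr E. nrm E x < 1}"

definition multi_quotient ::
  "'a::real_vector mnspace \<Rightarrow> 'b::real_vector mnspace \<Rightarrow> ('a \<Rightarrow> 'b) \<Rightarrow> bool" where
  "multi_quotient Y X q \<longleftrightarrow>
     linear_map Y X q \<and>
     (\<forall>n\<ge>1. tensor_right q ` open_ball (tensor_space n Y) = open_ball (tensor_space n X))"

(* HOL cannot quantify over types inside a formula, so the ambient types of the test spaces Y and
   X are parameters; a theorem in which they are type variables covers all test spaces. *)

definition one_projective ::
  "'y::real_vector itself \<Rightarrow> 'x::real_vector itself \<Rightarrow> ennreal \<Rightarrow> 'z::real_vector mnspace \<Rightarrow> bool" where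
  "one_projective _ _ p Z \<longleftrightarrow>
     multinormed_space p Z \<and>
     (\<forall>\<epsilon>::real. \<forall>(Y::'y mnspace) (X::'x mnspace) q u.
        \<epsilon> > 0 \<longrightarrow> multinormed_space p Y \<longrightarrow> multinormed_space p X \<longrightarrow>
        multi_quotient Y X q \<longrightarrow> multibounded Z X u \<longrightarrow>
        (\<exists>v. linear_map Z Y v \<and> multibound Z Y v \<le> multibound Z X u + ennreal \<epsilon> \<and>
             (\<forall>z\<in>carr Z. q (v z) = u z)))"

(* The norm on the tensor product with l^p_n is the injective one. *)

definition min_mn :: "ennreal \<Rightarrow> 'a::real_vector nspace \<Rightarrow> 'a mnspace" where
  "min_mn p E = \<lparr>
     carr = carr E,
     nrm = nrm E,
     tnrm = (\<lambda>n w. SUP (a, f)\<in>dual_ball (ellp p n) \<times> dual_ball E. \<bar>tensor_pairing n a f w\<bar>)\<rparr>"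

(* Families indexed by I are functions vanishing outside I.  The i-th component of a tuple w of
   such families is the tuple (\<lambda>k. w k i). *)

definition l1_sum :: "'i set \<Rightarrow> ('i \<Rightarrow> 'a::real_vector mnspace) \<Rightarrow> ('i \<Rightarrow> 'a) mnspace" where
  "l1_sum I X = \<lparr>
     carr = {z. (\<forall>i\<in>I. z i \<in> carr (X i)) \<and> (\<forall>i. i \<notin> I \<longrightarrow> z i = 0) \<and>
                (\<lambda>i. nrm (X i) (z i)) summable_on I},
     nrm = (\<lambda>z. \<Sum>\<^sub>\<infinity>i\<in>I. nrm (X i) (z i)),
     tnrm = (\<lambda>n w. \<Sum>\<^sub>\<infinity>i\<in>I. nrm (tensor_space n (X i)) (\<lambda>k. w k i))\<rparr>"

end

(* Since l^p'_N is the dual of l^p_N, an element of l^p_n (x) min_p(l^p'_N) is an operator from l^p_N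
   to l^p_n with its operator norm.  By the left tensoriality of X, the multibounded maps from
   min_p(l^p'_N) to X are therefore the elements of l^p_N (x) X, isometrically, and a p-quotient map
   Y -> X lifts these with arbitrarily small loss of norm.  A map out of an l^1 sum is a uniformly
   bounded family of maps out of the summands, so the lifts of its restrictions add up to a lift. *)

theory Submission
  imports Defs
begin

section \<open>The spaces \<open>\<ell>\<^sup>p\<^sub>n\<close>\<close>

text \<open>For a single summand everything rests on one tensor. Let J in l^p_N (x) l^p'_N represent
  the identity of l^p_N; its injective norm is at most 1. An arbitrary w in l^p_n (x) l^p'_N is (T
  (x) I) J for the operator T that w represents, and the norm of T is at most that of w. So only the
  tensor (I (x) u) J has to be lifted, to some V: the lift of u sends w to (T (x) I) V, and axiom
  (3) in Y bounds this for all n at once. A quotient map lifts open balls only, so a tensor of norm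
  at most c gets a lift of norm below c + \<epsilon>; nothing else costs \<epsilon>. In the l^1 sum
  every summand may spend the same \<epsilon>, since bounds on the summands combine as a supremum.

  The index set may be uncountable, so lifts are added along the net of finite subsets, and
  estimates are proved for finite partial sums up to an error that tends to 0. Norming functionals
  are needed for the injective norm to be a cross-norm; on l^p_n they come explicitly from the
  equality case of Hoelder's inequality.\<close>

lemma ellp_carr [simp]: "carr (ellp p n) = {a. \<forall>i\<ge>n. a i = 0}"
  by (simp add: ellp_def)

text \<open>In \<open>ennreal\<close>, 1/\<infinity> is 0 and 1/0 is \<infinity>, so the equation
  excludes the exponent 0 and leaves the two endpoint pairs and pairs of reals above 1. The norm
  formula changes at \<infinity>, and the proofs below split along these cases.\<close>

lemma conjugate_cases:
  fixes p p' :: ennreal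
  assumes "1 / p + 1 / p' = 1"
  obtains "p = 1" "p' = \<infinity>" | "p = \<infinity>" "p' = 1"
    | r s where "1 < r" "1 < s" "1 / r + 1 / s = 1" "p = ennreal r" "p' = ennreal s"
proof -
  consider "p = \<infinity>" | "p' = \<infinity>" | r s where "p = ennreal r" "0 \<le> r" "p' = ennreal s" "0 \<le> s"
    by (metis ennreal_cases infinity_ennreal_def)
  then show thesis
  proof cases
    case 1
    with assms have "1 / p' = 1" by simp
    then have "p' = 1"
      by (metis divide_eq_1_ennreal)
    with 1 that show ?thesis by blast
  next
    case 2
    with assms have "1 / p = 1" by simp
    then have "p = 1"
      by (metis divide_eq_1_ennreal)
    with 2 that show ?thesis by blast
  next
    case 3
    have "r \<noteq> 0" "s \<noteq> 0"
      using assms 3 by (auto simp: ennreal_divide_zero top_unique)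
    with 3 have rs: "r > 0" "s > 0" by auto
    have "ennreal (1 / r + 1 / s) = ennreal 1"
      using assms 3 rs by (simp add: divide_ennreal flip: ennreal_plus ennreal_1)
    then have eq: "1 / r + 1 / s = 1"
      using rs by (subst (asm) ennreal_inj) auto
    moreover have "1 / r < 1" "1 / s < 1"
      using eq rs by (smt (verit) divide_pos_pos)+
    then have "1 < r" "1 < s"
      using rs by (auto simp: field_simps)
    ultimately show ?thesis
      using that 3 by blast
  qed
qed

lemma ellp_nrm_top: "nrm (ellp top n) a = Max ((\<lambda>i. \<bar>a i\<bar>) ` {..<n})"
  by (simp add: ellp_def)

lemma ellp_nrm_one: "nrm (ellp 1 n) a = (\<Sum>i<n. \<bar>a i\<bar>)"
  by (simp add: ellp_def sum_nonneg)

lemma ellp_nrm_finite: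
  "0 \<le> r \<Longrightarrow> nrm (ellp (ennreal r) n) a = (\<Sum>i<n. \<bar>a i\<bar> powr r) powr (1 / r)"
  by (simp add: ellp_def)

text \<open>For n = 0 and p = \<infinity> the norm is the \<open>Max\<close> of an empty set, about
  which nothing is known; hence the recurring condition \<open>1 \<le> n\<close>.\<close>

lemma ellp_nonneg: "1 \<le> n \<Longrightarrow> 0 \<le> nrm (ellp p n) a"
  by (auto simp: ellp_def Max_ge_iff lessThan_empty_iff intro!: exI [of _ 0])

lemma ellp_scale:
  assumes "1 / p + 1 / p' = 1" "1 \<le> n"
  shows "nrm (ellp p n) (c *\<^sub>R a) = \<bar>c\<bar> * nrm (ellp p n) a"
  using assms(1)
proof (cases rule: conjugate_cases)
  case 1
  then show ?thesis
    by (simp add: ellp_nrm_one scaleR_fun_def abs_mult sum_distrib_left)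
next
  case 2
  have "Max ((\<lambda>i. \<bar>c * a i\<bar>) ` {..<n}) = Max ((\<lambda>x. \<bar>c\<bar> * x) ` (\<lambda>i. \<bar>a i\<bar>) ` {..<n})"
    by (simp add: image_image abs_mult)
  also have "\<dots> = \<bar>c\<bar> * Max ((\<lambda>i. \<bar>a i\<bar>) ` {..<n})"
    using assms(2)
    by (intro mono_Max_commute [symmetric]) (auto simp: mono_def mult_left_mono lessThan_empty_iff)
  finally show ?thesis
    using 2 by (simp add: ellp_nrm_top scaleR_fun_def)
next
  case (3 r s)
  then show ?thesis
    by (simp add: ellp_nrm_finite scaleR_fun_def abs_mult powr_mult powr_powr sum_nonneg
        flip: sum_distrib_left)
qed

lemma ellp_coordinate:
  assumes "1 / p + 1 / p' = 1" "i < n"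
  shows "\<bar>a i\<bar> \<le> nrm (ellp p n) a"
  using assms(1)
proof (cases rule: conjugate_cases)
  case 1
  then show ?thesis
    using member_le_sum [of i "{..<n}" "\<lambda>i. \<bar>a i\<bar>"] assms(2) by (simp add: ellp_nrm_one)
next
  case 2
  then show ?thesis
    using assms(2) by (simp add: ellp_nrm_top)
next
  case (3 r s)
  have "\<bar>a i\<bar> = (\<bar>a i\<bar> powr r) powr (1 / r)"
    using 3 by (simp add: powr_powr)
  also have "\<dots> \<le> (\<Sum>i<n. \<bar>a i\<bar> powr r) powr (1 / r)"
    using member_le_sum [of i "{..<n}" "\<lambda>i. \<bar>a i\<bar> powr r"] assms(2) 3
    by (intro powr_mono2) auto
  finally show ?thesis
    using 3 by (simp add: ellp_nrm_finite)
qed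

lemma ellp_unit_vec:
  assumes "1 / p + 1 / p' = 1" "k < n"
  shows "nrm (ellp p n) (unit_vec k) = 1"
  using assms(1)
proof (cases rule: conjugate_cases)
  case 1
  then show ?thesis
    using assms(2) by (simp add: ellp_nrm_one unit_vec_def if_distrib cong: if_cong)
next
  case 2
  then show ?thesis
    using assms(2) by (auto simp: ellp_nrm_top unit_vec_def intro!: Max_eqI image_eqI [of _ _ k])
next
  case (3 r s)
  have "(\<Sum>i<n. \<bar>unit_vec k i\<bar> powr r) = (\<Sum>i<n. if i = k then 1 else 0)"
    by (intro sum.cong) (auto simp: unit_vec_def)
  then show ?thesis
    using 3 assms(2) by (simp add: ellp_nrm_finite)
qed

lemma ellp_eq_0:
  assumes "1 / p + 1 / p' = 1" "a \<in> carr (ellp p n)" "nrm (ellp p n) a = 0"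
  shows "a = 0"
proof
  fix i
  show "a i = 0 i"
    using ellp_coordinate [OF assms(1), of i n a] assms(2,3) by (cases "i < n") auto
qed

text \<open>Young's inequality is summed after scaling both vectors to norm 1, which turns the right
  side into 1/r + 1/s = 1; a zero vector cannot be scaled and is split off. The endpoint pairs need
  only that a sum of products is at most the sum of one factor times the maximum of the
  other.\<close>

lemma holder_ellp:
  assumes "1 / p + 1 / p' = 1" "1 \<le> n"
  shows "\<bar>\<Sum>i<n. a i * b i\<bar> \<le> nrm (ellp p n) a * nrm (ellp p' n) b"
proof -
  have sup: "(\<Sum>i<n. \<bar>x i * y i\<bar>) \<le> (\<Sum>i<n. \<bar>x i\<bar>) * Max ((\<lambda>i. \<bar>y i\<bar>) ` {..<n})"
    for x y :: "nat \<Rightarrow> real"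
    unfolding sum_distrib_right abs_mult
    by (intro sum_mono mult_left_mono Max_ge) auto
  have "(\<Sum>i<n. \<bar>a i * b i\<bar>) \<le> nrm (ellp p n) a * nrm (ellp p' n) b"
    using assms(1)
  proof (cases rule: conjugate_cases)
    case 1
    then show ?thesis
      using sup [of a b] by (simp add: ellp_nrm_one ellp_nrm_top)
  next
    case 2
    then show ?thesis
      using sup [of b a] by (simp add: ellp_nrm_one ellp_nrm_top mult.commute)
  next
    case (3 r s)
    define A where "A = (\<Sum>i<n. \<bar>a i\<bar> powr r)"
    define B where "B = (\<Sum>i<n. \<bar>b i\<bar> powr s)"
    have nonneg: "A \<ge> 0" "B \<ge> 0"
      by (auto simp: A_def B_def sum_nonneg)
    have nrms: "nrm (ellp p n) a = A powr (1 / r)" "nrm (ellp p' n) b = B powr (1 / s)"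
      using 3 by (simp_all add: ellp_nrm_finite A_def B_def)
    show ?thesis
    proof (cases "A = 0 \<or> B = 0")
      case True
      then have "\<forall>i\<in>{..<n}. a i * b i = 0"
        by (auto simp: A_def B_def sum_nonneg_eq_0_iff)
      then have "(\<Sum>i<n. \<bar>a i * b i\<bar>) = 0"
        by (intro sum.neutral) simp
      then show ?thesis
        by (simp add: nrms)
    next
      case False
      with nonneg have pos: "A > 0" "B > 0" by auto
      define \<alpha> where "\<alpha> = A powr (1 / r)"
      define \<beta> where "\<beta> = B powr (1 / s)"
      have ab: "\<alpha> > 0" "\<beta> > 0" "\<alpha> powr r = A" "\<beta> powr s = B"
        using pos 3 by (auto simp: \<alpha>_def \<beta>_def powr_powr)
      have "(\<Sum>i<n. (\<bar>a i\<bar> / \<alpha>) * (\<bar>b i\<bar> / \<beta>))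
          \<le> (\<Sum>i<n. (\<bar>a i\<bar> / \<alpha>) powr r / r + (\<bar>b i\<bar> / \<beta>) powr s / s)"
        using 3 ab by (intro sum_mono Youngs_inequality) auto
      also have "\<dots> = (\<Sum>i<n. \<bar>a i\<bar> powr r) / A / r + (\<Sum>i<n. \<bar>b i\<bar> powr s) / B / s"
        using ab by (simp add: sum.distrib powr_divide sum_divide_distrib)
      also have "\<dots> = 1"
        using pos 3 by (simp flip: A_def B_def)
      finally have "(\<Sum>i<n. (\<bar>a i\<bar> / \<alpha>) * (\<bar>b i\<bar> / \<beta>)) \<le> 1" .
      moreover have "(\<Sum>i<n. (\<bar>a i\<bar> / \<alpha>) * (\<bar>b i\<bar> / \<beta>)) = (\<Sum>i<n. \<bar>a i * b i\<bar>) / (\<alpha> * \<beta>)"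
        by (simp add: abs_mult sum_divide_distrib)
      ultimately show ?thesis
        using ab by (simp add: nrms divide_le_eq flip: \<alpha>_def \<beta>_def)
    qed
  qed
  then show ?thesis
    using sum_abs [of "\<lambda>i. a i * b i" "{..<n}"] by linarith
qed

text \<open>The witness b consists of the signs of a for p = 1, is one signed coordinate where |a|
  is largest for p = \<infinity>, and is sgn a |a|^(r-1), scaled to norm 1, in between. All norming
  functionals below come from here.\<close>

lemma holder_ellp_attained:
  assumes "1 / p + 1 / p' = 1" "1 \<le> n"
  obtains b where "b \<in> carr (ellp p' n)" "nrm (ellp p' n) b \<le> 1"
    "(\<Sum>i<n. a i * b i) = nrm (ellp p n) a"
proof -
  have "\<exists>b. nrm (ellp p' n) b \<le> 1 \<and> (\<Sum>i<n. a i * b i) = nrm (ellp p n) a"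
    using assms(1)
  proof (cases rule: conjugate_cases)
    case 1
    have "nrm (ellp p' n) (\<lambda>i. sgn (a i)) \<le> 1"
      using assms(2) 1 by (auto simp: ellp_nrm_top lessThan_empty_iff abs_sgn_eq)
    moreover have "(\<Sum>i<n. a i * sgn (a i)) = nrm (ellp p n) a"
      using 1 by (simp add: ellp_nrm_one abs_sgn)
    ultimately show ?thesis by blast
  next
    case 2
    have "Max ((\<lambda>i. \<bar>a i\<bar>) ` {..<n}) \<in> (\<lambda>i. \<bar>a i\<bar>) ` {..<n}"
      using assms(2) by (intro Max_in) (auto simp: lessThan_empty_iff)
    then obtain k where k: "k < n" "Max ((\<lambda>i. \<bar>a i\<bar>) ` {..<n}) = \<bar>a k\<bar>"
      by auto
    define b where "b = (\<lambda>i. if i = k then sgn (a k) else 0)"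
    have "(\<Sum>i<n. \<bar>b i\<bar>) = (\<Sum>i<n. if i = k then \<bar>sgn (a k)\<bar> else 0)"
      by (intro sum.cong) (auto simp: b_def)
    moreover have "(\<Sum>i<n. a i * b i) = (\<Sum>i<n. if i = k then \<bar>a k\<bar> else 0)"
      by (intro sum.cong) (auto simp: b_def abs_sgn)
    ultimately show ?thesis
      using 2 k by (intro exI [of _ b]) (auto simp: ellp_nrm_one ellp_nrm_top abs_sgn_eq)
  next
    case (3 r s)
    define A where "A = (\<Sum>i<n. \<bar>a i\<bar> powr r)"
    have "A \<ge> 0"
      by (simp add: A_def sum_nonneg)
    have nrm_a: "nrm (ellp p n) a = A powr (1 / r)"
      using 3 by (simp add: ellp_nrm_finite A_def)
    show ?thesis
    proof (cases "A = 0")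
      case True
      have "nrm (ellp p' n) 0 \<le> 1"
        using 3 by (simp add: ellp_nrm_finite)
      moreover have "nrm (ellp p n) a = 0"
        using True by (simp add: nrm_a)
      ultimately show ?thesis
        by (intro exI [of _ 0]) simp
    next
      case False
      with \<open>A \<ge> 0\<close> have "A > 0" by simp
      \<comment> \<open>Since (r - 1) s = r, the powers |b|^s equal |a|^r / A and sum to 1, while
        the products a b equal |a|^r / A^(1/s) and sum to A^(1 - 1/s) = A^(1/r). For A = 0 there is
        nothing to divide by, but then b = 0 serves.\<close>
      define b where "b = (\<lambda>i. sgn (a i) * \<bar>a i\<bar> powr (r - 1) / A powr (1 / s))"
      have rs: "(r - 1) * s = r" "1 / r = 1 - 1 / s"
        using 3 by (auto simp: field_simps)
      have "\<bar>b i\<bar> powr s = \<bar>a i\<bar> powr r / A" for i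
      proof (cases "a i = 0")
        case False
        then show ?thesis
          using 3 rs \<open>A > 0\<close>
          by (simp add: b_def abs_mult abs_sgn_eq powr_divide powr_powr)
      qed (use 3 in \<open>simp add: b_def\<close>)
      then have "(\<Sum>i<n. \<bar>b i\<bar> powr s) = 1"
        using \<open>A > 0\<close> by (simp flip: sum_divide_distrib A_def)
      moreover have "a i * b i = \<bar>a i\<bar> powr r / A powr (1 / s)" for i
      proof (cases "a i = 0")
        case False
        have "a i * (sgn (a i) * \<bar>a i\<bar> powr (r - 1)) = a i * sgn (a i) * \<bar>a i\<bar> powr (r - 1)"
          by simp
        also have "\<dots> = \<bar>a i\<bar> powr 1 * \<bar>a i\<bar> powr (r - 1)"
          by (simp flip: abs_sgn)
        also have "\<dots> = \<bar>a i\<bar> powr r"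
          by (subst powr_add [symmetric]) simp
        finally show ?thesis
          by (simp add: b_def)
      qed (use 3 in \<open>simp add: b_def\<close>)
      then have "(\<Sum>i<n. a i * b i) = A / A powr (1 / s)"
        by (simp flip: sum_divide_distrib A_def)
      then have "(\<Sum>i<n. a i * b i) = A powr (1 / r)"
        using \<open>A > 0\<close> unfolding rs by (simp add: powr_diff)
      moreover have "nrm (ellp p' n) b = (\<Sum>i<n. \<bar>b i\<bar> powr s) powr (1 / s)"
        using 3 by (simp add: ellp_nrm_finite)
      ultimately show ?thesis
        unfolding nrm_a by (intro exI [of _ b]) simp
    qed
  qed
  then obtain b where b: "nrm (ellp p' n) b \<le> 1" "(\<Sum>i<n. a i * b i) = nrm (ellp p n) a"
    by blast
  \<comment> \<open>Neither the norm nor the sum sees coordinates from n on; b is cut off there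
    because the carrier demands zeros.\<close>
  define b' where "b' = (\<lambda>i. if i < n then b i else 0)"
  have "nrm (ellp p' n) b' = nrm (ellp p' n) b" "(\<Sum>i<n. a i * b' i) = (\<Sum>i<n. a i * b i)"
    by (auto simp: ellp_def b'_def cong: image_cong_simp intro!: arg_cong [where f = "\<lambda>x. x powr _"] sum.cong)
  with b that [of b'] show thesis
    by (simp add: b'_def)
qed

text \<open>The norm of a + b is the value of one pairing with a vector c in the conjugate unit
  ball. Splitting this value and applying Hoelder to each half gives Minkowski's inequality for all
  exponents at once.\<close>

lemma ellp_triangle:
  assumes "1 / p + 1 / p' = 1" "1 \<le> n"
  shows "nrm (ellp p n) (a + b) \<le> nrm (ellp p n) a + nrm (ellp p n) b"
proof -
  obtain c where c: "nrm (ellp p' n) c \<le> 1" "(\<Sum>i<n. (a + b) i * c i) = nrm (ellp p n) (a + b)"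
    using holder_ellp_attained [OF assms] by metis
  have bound: "(\<Sum>i<n. x i * c i) \<le> nrm (ellp p n) x" for x
  proof -
    have "(\<Sum>i<n. x i * c i) \<le> nrm (ellp p n) x * nrm (ellp p' n) c"
      using holder_ellp [OF assms, of x c] by linarith
    also have "\<dots> \<le> nrm (ellp p n) x"
      using c(1) ellp_nonneg [OF assms(2)] by (intro mult_left_le)
    finally show ?thesis .
  qed
  have "nrm (ellp p n) (a + b) = (\<Sum>i<n. a i * c i) + (\<Sum>i<n. b i * c i)"
    by (simp add: sum.distrib algebra_simps flip: c(2))
  also have "\<dots> \<le> nrm (ellp p n) a + nrm (ellp p n) b"
    by (intro add_mono bound)
  finally show ?thesis .
qed

section \<open>Completeness of l^p_n\<close>

lemma conjugate_commute: "1 / p + 1 / p' = 1 \<Longrightarrow> 1 / p' + 1 / p = (1 :: ennreal)"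
  by (simp add: add.commute)

text \<open>A norming vector has coordinates of modulus at most 1. With
  \<open>ellp_coordinate\<close> this makes norm convergence in l^p_n the same as coordinatewise
  convergence, so completeness reduces to that of the reals.\<close>

lemma ellp_le_sum:
  assumes "1 / p + 1 / p' = 1" "1 \<le> n"
  shows "nrm (ellp p n) a \<le> (\<Sum>i<n. \<bar>a i\<bar>)"
proof -
  obtain c where c: "nrm (ellp p' n) c \<le> 1" "(\<Sum>i<n. a i * c i) = nrm (ellp p n) a"
    using holder_ellp_attained [OF assms] by metis
  have "a i * c i \<le> \<bar>a i\<bar>" if "i < n" for i
  proof -
    have "\<bar>c i\<bar> \<le> 1"
      using ellp_coordinate [OF conjugate_commute [OF assms(1)] that, of c] c(1) by linarith
    then have "\<bar>a i\<bar> * \<bar>c i\<bar> \<le> \<bar>a i\<bar>"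
      by (intro mult_left_le) auto
    then show ?thesis
      by (metis abs_le_D1 abs_mult)
  qed
  then show ?thesis
    by (metis (mono_tags, lifting) c(2) lessThan_iff sum_mono)
qed

lemma normed_space_ellp:
  assumes "1 / p + 1 / p' = 1" "1 \<le> n"
  shows "normed_space (ellp p n)"
  unfolding normed_space_def
proof (intro conjI ballI allI)
  show "subspace (carr (ellp p n))"
    by (auto simp: subspace_def scaleR_fun_def)
  fix a
  assume a: "a \<in> carr (ellp p n)"
  show "0 \<le> nrm (ellp p n) a"
    by (rule ellp_nonneg [OF assms(2)])
  show "nrm (ellp p n) a = 0 \<longleftrightarrow> a = 0"
    using ellp_eq_0 [OF assms(1) a] ellp_scale [OF assms, of 0 a] by auto
qed (use ellp_scale [OF assms] ellp_triangle [OF assms] in auto)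

lemma banach_space_ellp:
  assumes "1 / p + 1 / p' = 1" "1 \<le> n"
  shows "banach_space (ellp p n)"
  unfolding banach_space_def
proof (intro conjI normed_space_ellp [OF assms] allI impI)
  fix s :: "nat \<Rightarrow> nat \<Rightarrow> real"
  assume s: "range s \<subseteq> carr (ellp p n)"
    and cauchy: "\<forall>e>0. \<exists>N. \<forall>i\<ge>N. \<forall>j\<ge>N. nrm (ellp p n) (s i - s j) < e"
  have "Cauchy (\<lambda>i. s i k)" if "k < n" for k
  proof (rule metric_CauchyI)
    fix e :: real
    assume "e > 0"
    with cauchy obtain N where "\<forall>i\<ge>N. \<forall>j\<ge>N. nrm (ellp p n) (s i - s j) < e"
      by blast
    moreover have "dist (s i k) (s j k) \<le> nrm (ellp p n) (s i - s j)" for i j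
      using ellp_coordinate [OF assms(1) that, of "s i - s j"] by (simp add: dist_real_def)
    ultimately show "\<exists>N. \<forall>i\<ge>N. \<forall>j\<ge>N. dist (s i k) (s j k) < e"
      by (meson le_less_trans)
  qed
  then have "\<exists>l. (\<lambda>i. s i k) \<longlonglongrightarrow> l" if "k < n" for k
    using that by (meson Cauchy_convergent convergent_def)
  then obtain l where l: "\<And>k. k < n \<Longrightarrow> (\<lambda>i. s i k) \<longlonglongrightarrow> l k"
    by metis
  define x where "x = (\<lambda>k. if k < n then l k else 0)"
  have "(\<lambda>i. s i k - x k) \<longlonglongrightarrow> 0" if "k < n" for k
    using l [OF that] that by (auto simp: x_def intro: LIM_zero)
  then have "(\<lambda>i. \<Sum>k<n. \<bar>(s i - x) k\<bar>) \<longlonglongrightarrow> 0"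
    by (intro tendsto_null_sum tendsto_rabs_zero) auto
  then have "(\<lambda>i. nrm (ellp p n) (s i - x)) \<longlonglongrightarrow> 0"
    by (rule tendsto_sandwich [OF _ _ tendsto_const, rotated 2])
      (intro always_eventually allI ellp_nonneg [OF assms(2)] ellp_le_sum [OF assms])+
  moreover have "x \<in> carr (ellp p n)"
    by (simp add: x_def)
  ultimately show "\<exists>x\<in>carr (ellp p n). (\<lambda>i. nrm (ellp p n) (s i - x)) \<longlonglongrightarrow> 0"
    by blast
qed

section \<open>Normed spaces with carriers\<close>

lemma normed_spaceD:
  assumes "normed_space E"
  shows normed_space_subspace: "subspace (carr E)"
    and normed_space_nonneg: "x \<in> carr E \<Longrightarrow> 0 \<le> nrm E x"
    and normed_space_eq_0: "x \<in> carr E \<Longrightarrow> nrm E x = 0 \<longleftrightarrow> x = 0"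
    and normed_space_scale: "x \<in> carr E \<Longrightarrow> nrm E (c *\<^sub>R x) = \<bar>c\<bar> * nrm E x"
    and normed_space_triangle: "x \<in> carr E \<Longrightarrow> y \<in> carr E \<Longrightarrow> nrm E (x + y) \<le> nrm E x + nrm E y"
  using assms by (auto simp: normed_space_def)

lemma normed_space_carr:
  assumes "normed_space E"
  shows normed_space_0: "0 \<in> carr E"
    and normed_space_add: "x \<in> carr E \<Longrightarrow> y \<in> carr E \<Longrightarrow> x + y \<in> carr E"
    and normed_space_diff: "x \<in> carr E \<Longrightarrow> y \<in> carr E \<Longrightarrow> x - y \<in> carr E"
    and normed_space_scaleR: "x \<in> carr E \<Longrightarrow> c *\<^sub>R x \<in> carr E"
    and normed_space_sum: "(\<And>i. i \<in> F \<Longrightarrow> g i \<in> carr E) \<Longrightarrow> sum g F \<in> carr E"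
  using normed_space_subspace [OF assms]
  by (auto intro: subspace_0 subspace_add subspace_diff subspace_scale subspace_sum)

lemma normed_space_nrm_0: "normed_space E \<Longrightarrow> nrm E 0 = 0"
  using normed_space_eq_0 normed_space_0 by metis

lemma normed_space_minus_commute:
  assumes "normed_space E" "x \<in> carr E" "y \<in> carr E"
  shows "nrm E (x - y) = nrm E (y - x)"
  using normed_space_scale [OF assms(1) normed_space_diff [OF assms], of "-1"] by simp

lemma normed_space_triangle_diff:
  assumes "normed_space E" "x \<in> carr E" "y \<in> carr E" "z \<in> carr E"
  shows "nrm E (x - z) \<le> nrm E (x - y) + nrm E (y - z)"
  using normed_space_triangle [OF assms(1), of "x - y" "y - z"] assms
  by (simp add: normed_space_diff)

lemma normed_space_sum_le:
  assumes "normed_space E" "\<And>i. i \<in> F \<Longrightarrow> g i \<in> carr E"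
  shows "nrm E (sum g F) \<le> (\<Sum>i\<in>F. nrm E (g i))"
  using assms(2)
proof (induction F rule: infinite_finite_induct)
  case (insert i F)
  then show ?case
    using normed_space_triangle [OF assms(1), of "g i" "sum g F"] normed_space_sum [OF assms(1), of F g]
    by force
qed (use normed_space_nrm_0 [OF assms(1)] in auto)

lemma banach_space_normed: "banach_space E \<Longrightarrow> normed_space E"
  by (simp add: banach_space_def)

section \<open>Linear maps, operator norms and dual balls\<close>

lemma linear_mapD:
  assumes "linear_map E F u"
  shows linear_map_carr: "x \<in> carr E \<Longrightarrow> u x \<in> carr F"
    and linear_map_add: "x \<in> carr E \<Longrightarrow> y \<in> carr E \<Longrightarrow> u (x + y) = u x + u y"
    and linear_map_scale: "x \<in> carr E \<Longrightarrow> u (c *\<^sub>R x) = c *\<^sub>R u x"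
  using assms by (auto simp: linear_map_def)

lemma linear_map_0:
  assumes "linear_map E F u" "normed_space E"
  shows "u 0 = 0"
  using linear_map_scale [OF assms(1) normed_space_0 [OF assms(2)], of 0] by simp

lemma linear_map_sum:
  assumes "linear_map E F u" "normed_space E" "\<And>i. i \<in> I \<Longrightarrow> g i \<in> carr E"
  shows "u (sum g I) = (\<Sum>i\<in>I. u (g i))"
  using assms(3)
  by (induction I rule: infinite_finite_induct)
    (simp_all add: linear_map_0 [OF assms(1,2)] linear_map_add [OF assms(1)] normed_space_sum [OF assms(2)])

lemma linear_map_diff:
  assumes "linear_map E F u" "normed_space E" "x \<in> carr E" "y \<in> carr E"
  shows "u (x - y) = u x - u y"
  using linear_map_add [OF assms(1,3), of "(-1) *\<^sub>R y"] linear_map_scale [OF assms(1,4), of "-1"]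
    normed_space_scaleR [OF assms(2,4), of "-1"] by simp

lemma linear_map_compose:
  "linear_map E F u \<Longrightarrow> linear_map F G v \<Longrightarrow> linear_map E G (\<lambda>x. v (u x))"
  by (auto simp: linear_map_def image_subset_iff)

text \<open>Replaces the \<open>ennreal\<close> supremum over the unit ball by an inequality with a
  real constant, the form in which bounds are used below. From left to right x is divided by its
  norm, so x = 0 is treated apart.\<close>

lemma op_norm_le_iff:
  assumes "normed_space E" "normed_space F" "linear_map E F u" "0 \<le> c"
  shows "op_norm E F u \<le> ennreal c \<longleftrightarrow> (\<forall>x\<in>carr E. nrm F (u x) \<le> c * nrm E x)"
proof
  assume le: "op_norm E F u \<le> ennreal c"
  show "\<forall>x\<in>carr E. nrm F (u x) \<le> c * nrm E x"
  proof
    fix x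
    assume x: "x \<in> carr E"
    show "nrm F (u x) \<le> c * nrm E x"
    proof (cases "x = 0")
      case True
      then show ?thesis
        using assms by (simp add: linear_map_0 normed_space_nrm_0)
    next
      case False
      then have pos: "nrm E x > 0"
        using x assms(1) normed_space_eq_0 normed_space_nonneg by (metis order_le_less)
      let ?y = "(1 / nrm E x) *\<^sub>R x"
      have y: "?y \<in> carr E" "nrm E ?y \<le> 1"
        using x pos assms(1) by (auto simp: normed_space_scaleR normed_space_scale)
      then have "ennreal (nrm F (u ?y)) \<le> op_norm E F u"
        unfolding op_norm_def by (intro SUP_upper) auto
      then have "nrm F (u ?y) \<le> c"
        using le assms(4) by (metis ennreal_le_iff order_trans)
      then show ?thesis
        using x pos assms linear_map_carr [OF assms(3) x]
        by (simp add: linear_map_scale [OF assms(3)] normed_space_scale pos_divide_le_eq)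
    qed
  qed
next
  assume bound: "\<forall>x\<in>carr E. nrm F (u x) \<le> c * nrm E x"
  show "op_norm E F u \<le> ennreal c"
    unfolding op_norm_def
  proof (rule SUP_least)
    fix x
    assume x: "x \<in> {x \<in> carr E. nrm E x \<le> 1}"
    then have "nrm F (u x) \<le> c * nrm E x"
      using bound by blast
    also have "\<dots> \<le> c"
      using x assms(4) by (intro mult_left_le) auto
    finally show "ennreal (nrm F (u x)) \<le> ennreal c"
      by (rule ennreal_leI)
  qed
qed

lemma bounded_mapsE:
  assumes "u \<in> bounded_maps E F" "normed_space E" "normed_space F"
  obtains c where "0 \<le> c" "op_norm E F u = ennreal c" "linear_map E F u"
    "\<And>x. x \<in> carr E \<Longrightarrow> nrm F (u x) \<le> c * nrm E x"
proof -
  have u: "linear_map E F u" "op_norm E F u < \<infinity>"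
    using assms(1) by (auto simp: bounded_maps_def)
  obtain c where c: "0 \<le> c" "op_norm E F u = ennreal c"
    using u(2) by (cases "op_norm E F u") auto
  with that u(1) op_norm_le_iff [OF assms(2,3) u(1) c(1)] show thesis
    by auto
qed

lemma bounded_mapsI:
  assumes "linear_map E F u" "normed_space E" "normed_space F" "0 \<le> c"
    "\<And>x. x \<in> carr E \<Longrightarrow> nrm F (u x) \<le> c * nrm E x"
  shows "u \<in> bounded_maps E F" "op_norm E F u \<le> ennreal c"
proof -
  show le: "op_norm E F u \<le> ennreal c"
    using op_norm_le_iff assms by blast
  then show "u \<in> bounded_maps E F"
    using assms(1) by (auto simp: bounded_maps_def intro: le_less_trans)
qed

lemma normed_space_scalars: "normed_space scalars"
  by (auto simp: normed_space_def scalars_def subspace_UNIV abs_mult)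

lemma scalars_simps [simp]: "carr scalars = UNIV" "nrm scalars = abs"
  by (simp_all add: scalars_def)

lemma dual_ball_iff:
  assumes "normed_space E"
  shows "f \<in> dual_ball E \<longleftrightarrow> linear_map E scalars f \<and> (\<forall>x\<in>carr E. \<bar>f x\<bar> \<le> nrm E x)"
proof
  assume f: "f \<in> dual_ball E"
  then have "linear_map E scalars f" "op_norm E scalars f \<le> ennreal 1"
    by (auto simp: dual_ball_def bounded_maps_def)
  then show "linear_map E scalars f \<and> (\<forall>x\<in>carr E. \<bar>f x\<bar> \<le> nrm E x)"
    using op_norm_le_iff [OF assms normed_space_scalars, of f 1] by simp
next
  assume "linear_map E scalars f \<and> (\<forall>x\<in>carr E. \<bar>f x\<bar> \<le> nrm E x)"
  then show "f \<in> dual_ball E"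
    using bounded_mapsI [OF _ assms normed_space_scalars, of f 1] by (simp add: dual_ball_def)
qed

lemma scale_mem_dual_ball:
  assumes "normed_space E" "linear_map E scalars f" "\<And>x. x \<in> carr E \<Longrightarrow> \<bar>f x\<bar> \<le> c * nrm E x" "0 < c"
  shows "(\<lambda>x. f x / c) \<in> dual_ball E"
  using assms by (auto simp: dual_ball_iff linear_map_def abs_div field_simps)

section \<open>Tensors as tuples of vectors\<close>

lemma tensor_space_simps [simp]:
  "carr (tensor_space n X) = tensor_carr n X" "nrm (tensor_space n X) = tnrm X n"
  by (simp_all add: tensor_space_def)

lemma min_mn_simps [simp]: "carr (min_mn p E) = carr E" "nrm (min_mn p E) = nrm E"
  by (simp_all add: min_mn_def)

lemma tensor_carrI:
  "(\<And>k. k < n \<Longrightarrow> w k \<in> carr X) \<Longrightarrow> (\<And>k. n \<le> k \<Longrightarrow> w k = 0) \<Longrightarrow> w \<in> tensor_carr n X"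
  by (simp add: tensor_carr_def)

lemma tensor_carr_0: "w \<in> tensor_carr n X \<Longrightarrow> n \<le> k \<Longrightarrow> w k = 0"
  by (simp add: tensor_carr_def)

lemma tensor_carr_mem:
  assumes "normed_space X" "w \<in> tensor_carr n X"
  shows "w k \<in> carr X"
  using assms normed_space_0 by (cases "k < n") (auto simp: tensor_carr_def)

lemma subspace_tensor_carr: "normed_space X \<Longrightarrow> subspace (tensor_carr n X)"
  by (auto simp: subspace_def tensor_carr_def scaleR_fun_def normed_space_carr)

lemma tensor_right_carr:
  assumes "linear_map X Y u" "normed_space X" "w \<in> tensor_carr n X"
  shows "tensor_right u w \<in> tensor_carr n Y"
  using assms by (auto simp: tensor_right_def tensor_carr_def linear_map_carr linear_map_0)

lemma linear_map_tensor_right: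
  assumes "linear_map X Y u" "normed_space X"
  shows "linear_map (tensor_space n X) (tensor_space n Y) (tensor_right u)"
  using tensor_right_carr [OF assms] tensor_carr_mem [OF assms(2)] linear_mapD [OF assms(1)]
  by (auto simp: linear_map_def tensor_right_def fun_eq_iff scaleR_fun_def)

lemma elem_tensor_carr:
  "normed_space X \<Longrightarrow> a \<in> carr (ellp p n) \<Longrightarrow> x \<in> carr X \<Longrightarrow> elem_tensor a x \<in> tensor_carr n X"
  by (auto simp: tensor_carr_def elem_tensor_def normed_space_scaleR)

lemma unit_vec_carr: "k < n \<Longrightarrow> unit_vec k \<in> carr (ellp p n)"
  by (auto simp: unit_vec_def)

lemma sum_fun_apply: "sum f F x = (\<Sum>i\<in>F. f i x)"
  by (induction F rule: infinite_finite_induct) simp_all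

lemma ellp_expansion:
  assumes "a \<in> carr (ellp p n)"
  shows "a = (\<Sum>k<n. a k *\<^sub>R unit_vec k)"
proof
  fix i
  have "(\<Sum>k<n. a k *\<^sub>R unit_vec k) i = (\<Sum>k<n. if i = k then a k else 0)"
    by (simp add: sum_fun_apply scaleR_fun_def unit_vec_def if_distrib cong: if_cong)
  then show "a i = (\<Sum>k<n. a k *\<^sub>R unit_vec k) i"
    using assms by simp
qed

lemma linear_map_ellp_expansion:
  assumes "normed_space (ellp p n)" "linear_map (ellp p n) F T" "a \<in> carr (ellp p n)"
  shows "T a = (\<Sum>k<n. a k *\<^sub>R T (unit_vec k))"
proof -
  have "T a = T (\<Sum>k<n. a k *\<^sub>R unit_vec k)"
    by (rule arg_cong [OF ellp_expansion [OF assms(3)]])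
  also have "\<dots> = (\<Sum>k<n. T (a k *\<^sub>R unit_vec k))"
    by (intro linear_map_sum [OF assms(2,1)] normed_space_scaleR [OF assms(1)] unit_vec_carr) auto
  also have "\<dots> = (\<Sum>k<n. a k *\<^sub>R T (unit_vec k))"
    by (intro sum.cong refl linear_map_scale [OF assms(2)] unit_vec_carr) auto
  finally show ?thesis .
qed

lemma tensor_left_apply:
  "tensor_left n T w j = (\<Sum>k<n. T (unit_vec k) j *\<^sub>R w k)"
  by (simp add: tensor_left_def elem_tensor_def sum_fun_apply)

lemma tensor_left_carr:
  assumes "normed_space X" "linear_map (ellp p n) (ellp p m) T" "w \<in> tensor_carr n X"
  shows "tensor_left n T w \<in> tensor_carr m X"
proof (rule tensor_carrI)
  fix j
  show "tensor_left n T w j \<in> carr X"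
    using assms by (auto simp: tensor_left_apply tensor_carr_mem intro!: normed_space_sum normed_space_scaleR)
  assume "m \<le> j"
  then have "T (unit_vec k) j = 0" if "k < n" for k
    using linear_map_carr [OF assms(2) unit_vec_carr [OF that]] by simp
  then show "tensor_left n T w j = 0"
    by (simp add: tensor_left_apply)
qed

section \<open>Duality between l^p_n and l^p'_n\<close>

lemma ellp_functional:
  assumes "1 / p + 1 / p' = 1" "1 \<le> n" "nrm (ellp p' n) b \<le> c"
  shows "linear_map (ellp p n) scalars (\<lambda>a. \<Sum>k<n. a k * b k)"
    and "\<bar>\<Sum>k<n. a k * b k\<bar> \<le> c * nrm (ellp p n) a"
proof -
  show "linear_map (ellp p n) scalars (\<lambda>a. \<Sum>k<n. a k * b k)"
    by (auto simp: linear_map_def sum.distrib algebra_simps scaleR_fun_def sum_distrib_left)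
  have "\<bar>\<Sum>k<n. a k * b k\<bar> \<le> nrm (ellp p n) a * nrm (ellp p' n) b"
    by (rule holder_ellp [OF assms(1,2)])
  also have "\<dots> \<le> c * nrm (ellp p n) a"
    using mult_left_mono [OF assms(3) ellp_nonneg [OF assms(2)]] by (simp add: mult.commute)
  finally show "\<bar>\<Sum>k<n. a k * b k\<bar> \<le> c * nrm (ellp p n) a" .
qed

lemma ellp_norming:
  assumes "1 / p + 1 / p' = 1" "1 \<le> n"
  shows "\<exists>f\<in>dual_ball (ellp p n). f a = nrm (ellp p n) a"
proof -
  obtain b where b: "nrm (ellp p' n) b \<le> 1" "(\<Sum>i<n. a i * b i) = nrm (ellp p n) a"
    using holder_ellp_attained [OF assms] by metis
  have "(\<lambda>a. \<Sum>k<n. a k * b k) \<in> dual_ball (ellp p n)"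
    using ellp_functional [OF assms b(1)] by (simp add: dual_ball_iff [OF normed_space_ellp [OF assms]])
  with b(2) show ?thesis
    by (intro bexI [of _ "\<lambda>a. \<Sum>k<n. a k * b k"]) auto
qed

text \<open>The coefficient vector of f is normed by some a in the unit ball of l^p_n, and its
  pairing with a is f a. Together with \<open>ellp_functional\<close> this identifies the dual of
  l^p_n with l^p'_n isometrically.\<close>

lemma dual_ball_ellp:
  assumes "1 / p + 1 / p' = 1" "1 \<le> n" "f \<in> dual_ball (ellp p n)"
  shows "nrm (ellp p' n) (\<lambda>k. if k < n then f (unit_vec k) else 0) \<le> 1" (is "nrm _ ?b \<le> 1")
proof -
  note normed = normed_space_ellp [OF assms(1,2)]
  have f: "linear_map (ellp p n) scalars f" "\<And>x. x \<in> carr (ellp p n) \<Longrightarrow> \<bar>f x\<bar> \<le> nrm (ellp p n) x"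
    using assms(3) dual_ball_iff [OF normed] by auto
  obtain a where a: "a \<in> carr (ellp p n)" "nrm (ellp p n) a \<le> 1"
    "(\<Sum>i<n. ?b i * a i) = nrm (ellp p' n) ?b"
    by (rule holder_ellp_attained [OF conjugate_commute [OF assms(1)] assms(2)])
  have "f a = (\<Sum>k<n. ?b k * a k)"
    using linear_map_ellp_expansion [OF normed f(1) a(1)] by (simp add: mult.commute)
  with a f(2) [OF a(1)] show ?thesis by linarith
qed

section \<open>Multinormed spaces\<close>

lemma tensor_pairing_add:
  assumes "linear_map X scalars f" "normed_space X" "w \<in> tensor_carr n X" "w' \<in> tensor_carr n X"
  shows "tensor_pairing n a f (w + w') = tensor_pairing n a f w + tensor_pairing n a f w'"
  using tensor_carr_mem [OF assms(2,3)] tensor_carr_mem [OF assms(2,4)]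
  by (simp add: tensor_pairing_def linear_map_add [OF assms(1)] sum.distrib algebra_simps)

lemma tensor_pairing_scale:
  assumes "linear_map X scalars f" "normed_space X" "w \<in> tensor_carr n X"
  shows "tensor_pairing n a f (c *\<^sub>R w) = c * tensor_pairing n a f w"
  using tensor_carr_mem [OF assms(2,3)]
  by (simp add: tensor_pairing_def linear_map_scale [OF assms(1)] scaleR_fun_def sum_distrib_left ac_simps)

lemma tensor_pairing_elem:
  assumes "normed_space (ellp p n)" "linear_map (ellp p n) scalars a" "linear_map X scalars f"
    "b \<in> carr (ellp p n)" "x \<in> carr X"
  shows "tensor_pairing n a f (elem_tensor b x) = a b * f x"
  using assms
  by (simp add: tensor_pairing_def elem_tensor_def linear_map_ellp_expansion [OF assms(1,2,4)]
      linear_map_scale [OF assms(3,5)] sum_distrib_left sum_distrib_right ac_simps)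

text \<open>Transposes T (x) I onto the functional a. For an injective norm, axiom (3) then only
  asks how large the composite of T and a is.\<close>

lemma tensor_pairing_left:
  assumes "normed_space (ellp p m)" "linear_map (ellp p m) scalars a"
    "linear_map (ellp p n) (ellp p m) T" "linear_map X scalars f" "normed_space X" "w \<in> tensor_carr n X"
  shows "tensor_pairing m a f (tensor_left n T w) = tensor_pairing n (\<lambda>x. a (T x)) f w"
proof -
  have "f (tensor_left n T w j) = (\<Sum>k<n. T (unit_vec k) j * f (w k))" for j
  proof -
    have "f (tensor_left n T w j) = (\<Sum>k<n. f (T (unit_vec k) j *\<^sub>R w k))"
      unfolding tensor_left_apply
      by (intro linear_map_sum [OF assms(4,5)] normed_space_scaleR [OF assms(5)] tensor_carr_mem [OF assms(5,6)])
    also have "\<dots> = (\<Sum>k<n. T (unit_vec k) j * f (w k))"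
      using tensor_carr_mem [OF assms(5,6)] by (simp add: linear_map_scale [OF assms(4)])
    finally show ?thesis .
  qed
  then have "tensor_pairing m a f (tensor_left n T w)
      = (\<Sum>j<m. \<Sum>k<n. a (unit_vec j) * (T (unit_vec k) j * f (w k)))"
    by (simp add: tensor_pairing_def sum_distrib_left)
  also have "\<dots> = (\<Sum>k<n. \<Sum>j<m. a (unit_vec j) * (T (unit_vec k) j * f (w k)))"
    by (rule sum.swap)
  also have "\<dots> = (\<Sum>k<n. a (T (unit_vec k)) * f (w k))"
  proof (rule sum.cong [OF refl])
    fix k
    assume "k \<in> {..<n}"
    then have "T (unit_vec k) \<in> carr (ellp p m)"
      by (intro linear_map_carr [OF assms(3)] unit_vec_carr) auto
    from linear_map_ellp_expansion [OF assms(1,2) this]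
    show "(\<Sum>j<m. a (unit_vec j) * (T (unit_vec k) j * f (w k))) = a (T (unit_vec k)) * f (w k)"
      by (simp add: sum_distrib_left ac_simps)
  qed
  finally show ?thesis
    by (simp add: tensor_pairing_def)
qed

text \<open>The condition on operators is stated for an arbitrary real bound c of T, so that
  instances are checked without \<open>ennreal\<close>; the operator norm of T in place of c gives
  axiom (3). \<open>multinormed_left\<close> translates in the other direction.\<close>

lemma multinormed_spaceI:
  assumes "1 / p + 1 / p' = 1" "banach_space X"
    "\<And>n. 1 \<le> n \<Longrightarrow> normed_space (tensor_space n X)"
    "\<And>n a x. 1 \<le> n \<Longrightarrow> a \<in> carr (ellp p n) \<Longrightarrow> x \<in> carr X \<Longrightarrow>
      tnrm X n (elem_tensor a x) = nrm (ellp p n) a * nrm X x"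
    "\<And>n a f w. 1 \<le> n \<Longrightarrow> w \<in> tensor_carr n X \<Longrightarrow> a \<in> dual_ball (ellp p n) \<Longrightarrow> f \<in> dual_ball X \<Longrightarrow>
      \<bar>tensor_pairing n a f w\<bar> \<le> tnrm X n w"
    "\<And>m n T c w. 1 \<le> m \<Longrightarrow> 1 \<le> n \<Longrightarrow> linear_map (ellp p n) (ellp p m) T \<Longrightarrow> 0 \<le> c \<Longrightarrow>
      (\<And>x. x \<in> carr (ellp p n) \<Longrightarrow> nrm (ellp p m) (T x) \<le> c * nrm (ellp p n) x) \<Longrightarrow>
      w \<in> tensor_carr n X \<Longrightarrow> tnrm X m (tensor_left n T w) \<le> c * tnrm X n w"
  shows "multinormed_space p X"
proof -
  have "ennreal (tnrm X m (tensor_left n T w)) \<le> op_norm (ellp p n) (ellp p m) T * ennreal (tnrm X n w)"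
    if mn: "1 \<le> m" "1 \<le> n" and T: "T \<in> bounded_maps (ellp p n) (ellp p m)"
      and w: "w \<in> tensor_carr n X" for m n T w
  proof -
    obtain c where c: "0 \<le> c" "op_norm (ellp p n) (ellp p m) T = ennreal c" "linear_map (ellp p n) (ellp p m) T"
      "\<And>x. x \<in> carr (ellp p n) \<Longrightarrow> nrm (ellp p m) (T x) \<le> c * nrm (ellp p n) x"
      using bounded_mapsE [OF T normed_space_ellp [OF assms(1) mn(2)] normed_space_ellp [OF assms(1) mn(1)]]
      by blast
    have "tnrm X m (tensor_left n T w) \<le> c * tnrm X n w"
      by (rule assms(6) [OF mn c(3,1,4) w])
    then show ?thesis
      using c(1) by (simp add: c(2) ennreal_leI flip: ennreal_mult')
  qed
  with assms show ?thesis
    by (auto simp: multinormed_space_def)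
qed

lemma multinormed_spaceD:
  assumes "multinormed_space p X"
  shows multinormed_banach: "banach_space X"
    and multinormed_normed: "normed_space X"
    and multinormed_tensor: "1 \<le> n \<Longrightarrow> normed_space (tensor_space n X)"
    and multinormed_elem: "1 \<le> n \<Longrightarrow> b \<in> carr (ellp p n) \<Longrightarrow> x \<in> carr X \<Longrightarrow>
      tnrm X n (elem_tensor b x) = nrm (ellp p n) b * nrm X x"
    and multinormed_pairing: "1 \<le> n \<Longrightarrow> w \<in> tensor_carr n X \<Longrightarrow> a \<in> dual_ball (ellp p n) \<Longrightarrow>
      f \<in> dual_ball X \<Longrightarrow> \<bar>tensor_pairing n a f w\<bar> \<le> tnrm X n w"
  using assms by (auto simp: multinormed_space_def banach_space_normed)

lemma multinormed_left:
  assumes "multinormed_space p X" "1 / p + 1 / p' = 1" "1 \<le> m" "1 \<le> n"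
    "linear_map (ellp p n) (ellp p m) T" "0 \<le> c"
    "\<And>x. x \<in> carr (ellp p n) \<Longrightarrow> nrm (ellp p m) (T x) \<le> c * nrm (ellp p n) x"
    "w \<in> tensor_carr n X"
  shows "tnrm X m (tensor_left n T w) \<le> c * tnrm X n w"
proof -
  have T: "T \<in> bounded_maps (ellp p n) (ellp p m)" "op_norm (ellp p n) (ellp p m) T \<le> ennreal c"
    using bounded_mapsI [OF assms(5) normed_space_ellp [OF assms(2,4)] normed_space_ellp [OF assms(2,3)] assms(6,7)]
    by auto
  have "ennreal (tnrm X m (tensor_left n T w)) \<le> op_norm (ellp p n) (ellp p m) T * ennreal (tnrm X n w)"
    using assms(1,3,4,8) T(1) by (auto simp: multinormed_space_def)
  also have "\<dots> \<le> ennreal c * ennreal (tnrm X n w)"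
    using T(2) by (intro mult_right_mono) auto
  also have "\<dots> = ennreal (c * tnrm X n w)"
    using assms(6) by (simp add: ennreal_mult')
  finally show ?thesis
    using assms(6) normed_space_nonneg [OF multinormed_tensor [OF assms(1,4)], of w] assms(8)
    by (subst (asm) ennreal_le_iff) auto
qed

lemma tensor_carr_expansion:
  assumes "w \<in> tensor_carr n X"
  shows "w = (\<Sum>k<n. elem_tensor (unit_vec k) (w k))"
proof
  fix j
  have "(\<Sum>k<n. elem_tensor (unit_vec k) (w k)) j = (\<Sum>k<n. if j = k then w k else 0)"
    by (simp add: sum_fun_apply elem_tensor_def unit_vec_def if_distrib [where f = "\<lambda>c. c *\<^sub>R _"] cong: if_cong)
  then show "w j = (\<Sum>k<n. elem_tensor (unit_vec k) (w k)) j"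
    using tensor_carr_0 [OF assms] by simp
qed

text \<open>Expands w along unit vectors, which have norm 1, and uses the cross-norm property on
  each term. This is how componentwise convergence controls the otherwise unspecified norm at level
  n.\<close>

lemma multinormed_le_sum:
  assumes "multinormed_space p X" "1 / p + 1 / p' = 1" "1 \<le> n" "w \<in> tensor_carr n X"
  shows "tnrm X n w \<le> (\<Sum>k<n. nrm X (w k))"
proof -
  note X = multinormed_normed [OF assms(1)]
  have elem: "elem_tensor (unit_vec k) (w k) \<in> tensor_carr n X" if "k < n" for k
    using elem_tensor_carr [OF X unit_vec_carr [OF that]] tensor_carr_mem [OF X assms(4)] .
  have "tnrm X n w = nrm (tensor_space n X) (\<Sum>k<n. elem_tensor (unit_vec k) (w k))"
    by (simp flip: tensor_carr_expansion [OF assms(4)])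
  also have "\<dots> \<le> (\<Sum>k<n. nrm (tensor_space n X) (elem_tensor (unit_vec k) (w k)))"
    using elem by (intro normed_space_sum_le multinormed_tensor [OF assms(1,3)]) auto
  also have "\<dots> = (\<Sum>k<n. nrm X (w k))"
    using multinormed_elem [OF assms(1,3) unit_vec_carr] ellp_unit_vec [OF assms(2)] tensor_carr_mem [OF X assms(4)]
    by (intro sum.cong) auto
  finally show ?thesis .
qed

section \<open>Multibounds and quotient maps\<close>

lemma multibound_le_iff:
  assumes "multinormed_space p Z" "multinormed_space p Y" "linear_map Z Y u" "0 \<le> c"
  shows "multibound Z Y u \<le> ennreal c \<longleftrightarrow>
    (\<forall>n\<ge>1. \<forall>w\<in>tensor_carr n Z. tnrm Y n (tensor_right u w) \<le> c * tnrm Z n w)"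
  using op_norm_le_iff [OF multinormed_tensor [OF assms(1)] multinormed_tensor [OF assms(2)]
      linear_map_tensor_right [OF assms(3) multinormed_normed [OF assms(1)]] assms(4)]
  by (auto simp: multibound_def SUP_le_iff)

lemma multiboundedE:
  assumes "multibounded Z Y u" "multinormed_space p Z" "multinormed_space p Y"
  obtains c where "0 \<le> c" "multibound Z Y u = ennreal c" "linear_map Z Y u"
    "\<And>n w. 1 \<le> n \<Longrightarrow> w \<in> tensor_carr n Z \<Longrightarrow> tnrm Y n (tensor_right u w) \<le> c * tnrm Z n w"
proof -
  have u: "linear_map Z Y u" "multibound Z Y u < \<infinity>"
    using assms(1) by (auto simp: multibounded_def)
  obtain c where c: "0 \<le> c" "multibound Z Y u = ennreal c"
    using u(2) by (cases "multibound Z Y u") auto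
  with that u(1) multibound_le_iff [OF assms(2,3) u(1) c(1)] show thesis
    by auto
qed

lemma tensor_right_elem:
  assumes "linear_map X Y u" "x \<in> carr X"
  shows "tensor_right u (elem_tensor a x) = elem_tensor a (u x)"
  using linear_map_scale [OF assms] by (simp add: tensor_right_def elem_tensor_def)

text \<open>Level 1 carries the norm of X itself. A bound at this level therefore bounds the
  underlying map, which is what makes u, q and the lifts continuous in the convergence
  arguments.\<close>

lemma multinormed_nrm:
  assumes "multinormed_space p X" "1 / p + 1 / p' = 1" "x \<in> carr X"
  shows "tnrm X 1 (elem_tensor (unit_vec 0) x) = nrm X x"
  using multinormed_elem [OF assms(1) _ unit_vec_carr assms(3), of 1 0] ellp_unit_vec [OF assms(2), of 0 1]
  by simp

lemma nrm_le_multibound: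
  assumes "multinormed_space p X" "multinormed_space p Y" "1 / p + 1 / p' = 1" "linear_map X Y u" "x \<in> carr X"
    "\<And>w. w \<in> tensor_carr 1 X \<Longrightarrow> tnrm Y 1 (tensor_right u w) \<le> c * tnrm X 1 w"
  shows "nrm Y (u x) \<le> c * nrm X x"
proof -
  have "elem_tensor (unit_vec 0) x \<in> tensor_carr 1 X"
    by (intro elem_tensor_carr [where p = p] multinormed_normed [OF assms(1)] unit_vec_carr assms(5)) simp
  from assms(6) [OF this] show ?thesis
    using multinormed_nrm [OF assms(1,3,5)] multinormed_nrm [OF assms(2,3) linear_map_carr [OF assms(4,5)]]
    by (simp add: tensor_right_elem [OF assms(4,5)])
qed

lemma tensor_right_scale:
  assumes "linear_map X Y u" "normed_space X" "w \<in> tensor_carr n X"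
  shows "tensor_right u (c *\<^sub>R w) = c *\<^sub>R tensor_right u w"
  using linear_map_scale [OF assms(1) tensor_carr_mem [OF assms(2,3)]]
  by (simp add: tensor_right_def scaleR_fun_def)

text \<open>Homogeneity passes from the open unit ball to every radius t. The inequality for w is
  obtained for each t above its norm, because w / t has to lie strictly inside the ball; for the
  same reason lifts are controlled only by a t that exceeds the norm of w'.\<close>

lemma multi_quotientD:
  assumes "multi_quotient Y X q" "multinormed_space p Y" "multinormed_space p X" "1 \<le> n"
  shows multi_quotient_le: "w \<in> tensor_carr n Y \<Longrightarrow> tnrm X n (tensor_right q w) \<le> tnrm Y n w"
    and multi_quotient_lift: "w' \<in> tensor_carr n X \<Longrightarrow> tnrm X n w' < t \<Longrightarrow>
      \<exists>w\<in>tensor_carr n Y. tensor_right q w = w' \<and> tnrm Y n w < t"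
proof -
  have q: "linear_map Y X q"
    "tensor_right q ` open_ball (tensor_space n Y) = open_ball (tensor_space n X)"
    using assms(1,4) by (auto simp: multi_quotient_def)
  note nY = multinormed_tensor [OF assms(2,4)] and nX = multinormed_tensor [OF assms(3,4)]
  note Y = multinormed_normed [OF assms(2)] and X = multinormed_normed [OF assms(3)]
  {
    assume w: "w \<in> tensor_carr n Y"
    show "tnrm X n (tensor_right q w) \<le> tnrm Y n w"
    proof (rule dense_ge)
      fix t
      assume t: "tnrm Y n w < t"
      then have "0 < t"
        using normed_space_nonneg [OF nY] w by force
      with t have "(1 / t) *\<^sub>R w \<in> open_ball (tensor_space n Y)"
        using normed_space_scale [OF nY, of w "1 / t"] normed_space_scaleR [OF nY, of w "1 / t"] w
        by (simp add: open_ball_def)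
      then have "tensor_right q ((1 / t) *\<^sub>R w) \<in> open_ball (tensor_space n X)"
        using q(2) by blast
      then have "tnrm X n ((1 / t) *\<^sub>R tensor_right q w) < 1"
        by (simp add: open_ball_def tensor_right_scale [OF q(1) Y w])
      then show "tnrm X n (tensor_right q w) \<le> t"
        using normed_space_scale [OF nX, of "tensor_right q w" "1 / t"] tensor_right_carr [OF q(1) Y w] \<open>0 < t\<close>
        by simp
    qed
  }
  assume w': "w' \<in> tensor_carr n X" and t: "tnrm X n w' < t"
  then have "0 < t"
    using normed_space_nonneg [OF nX] by force
  with t have "(1 / t) *\<^sub>R w' \<in> open_ball (tensor_space n X)"
    using normed_space_scale [OF nX, of w' "1 / t"] normed_space_scaleR [OF nX, of w' "1 / t"] w'
    by (simp add: open_ball_def)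
  then obtain v where v: "v \<in> open_ball (tensor_space n Y)" "tensor_right q v = (1 / t) *\<^sub>R w'"
    using q(2) by (metis (no_types, lifting) imageE)
  then have v': "v \<in> tensor_carr n Y" "tnrm Y n v < 1"
    by (auto simp: open_ball_def)
  have "tensor_right q (t *\<^sub>R v) = w'"
    using v(2) \<open>0 < t\<close> by (simp add: tensor_right_scale [OF q(1) Y v'(1)])
  moreover have "t *\<^sub>R v \<in> tensor_carr n Y" "tnrm Y n (t *\<^sub>R v) < t"
    using normed_space_scale [OF nY, of v t] normed_space_scaleR [OF nY, of v t] v' \<open>0 < t\<close> by simp_all
  ultimately show "\<exists>w\<in>tensor_carr n Y. tensor_right q w = w' \<and> tnrm Y n w < t"
    by blast
qed

section \<open>The minimal multinorm\<close>

lemma dual_ball_unit_vec: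
  assumes "1 / p + 1 / p' = 1" "a \<in> dual_ball (ellp p n)" "k < n"
  shows "\<bar>a (unit_vec k)\<bar> \<le> 1"
proof -
  have "normed_space (ellp p n)"
    using assms(3) by (intro normed_space_ellp [OF assms(1)]) auto
  then show ?thesis
    using assms(2) unit_vec_carr [OF assms(3)] ellp_unit_vec [OF assms(1,3)] by (metis dual_ball_iff)
qed

lemma zero_mem_dual_ball: "normed_space E \<Longrightarrow> (\<lambda>_. 0) \<in> dual_ball E"
  by (auto simp: dual_ball_iff linear_map_def normed_space_nonneg)

text \<open>A real supremum dominates its terms only if they are bounded above. The sum of the norms
  of the components is a bound for all a and f, because |a| is at most 1 on unit vectors and |f| is
  at most the norm.\<close>

lemma tnrm_min_mn_upper:
  assumes "1 / p + 1 / p' = 1" "normed_space E" "w \<in> tensor_carr n E"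
    "a \<in> dual_ball (ellp p n)" "f \<in> dual_ball E"
  shows "\<bar>tensor_pairing n a f w\<bar> \<le> tnrm (min_mn p E) n w"
proof -
  have "\<bar>tensor_pairing n a f w\<bar> \<le> (\<Sum>k<n. nrm E (w k))"
    if a: "a \<in> dual_ball (ellp p n)" and f: "f \<in> dual_ball E" for a f
  proof -
    have "\<bar>tensor_pairing n a f w\<bar> \<le> (\<Sum>k<n. \<bar>a (unit_vec k)\<bar> * \<bar>f (w k)\<bar>)"
      unfolding tensor_pairing_def by (rule order_trans [OF sum_abs]) (simp add: abs_mult)
    also have "\<dots> \<le> (\<Sum>k<n. 1 * nrm E (w k))"
      using f dual_ball_unit_vec [OF assms(1) a] tensor_carr_mem [OF assms(2,3)]
      by (intro sum_mono mult_mono) (auto simp: dual_ball_iff [OF assms(2)])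
    finally show ?thesis by simp
  qed
  then have "bdd_above ((\<lambda>(a, f). \<bar>tensor_pairing n a f w\<bar>) ` (dual_ball (ellp p n) \<times> dual_ball E))"
    by (intro bdd_aboveI2 [where M = "\<Sum>k<n. nrm E (w k)"]) auto
  from cSUP_upper [OF _ this, of "(a, f)"] assms(4,5) show ?thesis
    by (simp add: min_mn_def)
qed

lemma tnrm_min_mn_least:
  assumes "1 / p + 1 / p' = 1" "1 \<le> n" "normed_space E"
    "\<And>a f. a \<in> dual_ball (ellp p n) \<Longrightarrow> f \<in> dual_ball E \<Longrightarrow> \<bar>tensor_pairing n a f w\<bar> \<le> c"
  shows "tnrm (min_mn p E) n w \<le> c"
proof -
  have "dual_ball (ellp p n) \<times> dual_ball E \<noteq> {}"
    using zero_mem_dual_ball [OF normed_space_ellp [OF assms(1,2)]] zero_mem_dual_ball [OF assms(3)] by blast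
  then show ?thesis
    unfolding min_mn_def using assms(4) by (auto intro!: cSUP_least)
qed

lemma tnrm_min_mn_nonneg:
  assumes "1 / p + 1 / p' = 1" "1 \<le> n" "normed_space E" "w \<in> tensor_carr n E"
  shows "0 \<le> tnrm (min_mn p E) n w"
  using tnrm_min_mn_upper [OF assms(1,3,4) zero_mem_dual_ball [OF normed_space_ellp [OF assms(1,2)]]
    zero_mem_dual_ball [OF assms(3)]] by linarith

text \<open>Homogeneous form of \<open>tnrm_min_mn_upper\<close>, by rescaling both functionals into
  the dual balls. For s = 0 or t = 0 this is impossible, but then every term of the pairing
  vanishes.\<close>

lemma tensor_pairing_le_min_mn:
  assumes "1 / p + 1 / p' = 1" "1 \<le> n" "normed_space E" "w \<in> tensor_carr n E"
    and a: "linear_map (ellp p n) scalars a" "\<And>x. x \<in> carr (ellp p n) \<Longrightarrow> \<bar>a x\<bar> \<le> s * nrm (ellp p n) x" "0 \<le> s"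
    and f: "linear_map E scalars f" "\<And>x. x \<in> carr E \<Longrightarrow> \<bar>f x\<bar> \<le> t * nrm E x" "0 \<le> t"
  shows "\<bar>tensor_pairing n a f w\<bar> \<le> s * t * tnrm (min_mn p E) n w"
proof (cases "s = 0 \<or> t = 0")
  case True
  then have "a (unit_vec k) * f (w k) = 0" if "k < n" for k
    using a(2) [OF unit_vec_carr [OF that]] f(2) [OF tensor_carr_mem [OF assms(3,4)], of k] by auto
  then have "tensor_pairing n a f w = 0"
    unfolding tensor_pairing_def by (intro sum.neutral) blast
  with True show ?thesis by auto
next
  case False
  with a(3) f(3) have pos: "0 < s" "0 < t" by auto
  have "\<bar>tensor_pairing n (\<lambda>x. a x / s) (\<lambda>x. f x / t) w\<bar> \<le> tnrm (min_mn p E) n w"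
    by (intro tnrm_min_mn_upper [OF assms(1,3,4)] scale_mem_dual_ball a f pos assms(3)
        normed_space_ellp [OF assms(1,2)])
  moreover have "tensor_pairing n (\<lambda>x. a x / s) (\<lambda>x. f x / t) w = tensor_pairing n a f w / (s * t)"
    by (simp add: tensor_pairing_def sum_divide_distrib)
  ultimately show ?thesis
    using pos by (simp add: abs_mult field_simps)
qed

text \<open>\<open>norming\<close> plays the part of the Hahn-Banach theorem: it gives definiteness
  and the lower estimate in the cross-norm identity. For the spaces l^p'_N it is supplied by
  \<open>ellp_norming\<close>.\<close>

proposition multinormed_min_mn:
  assumes "1 / p + 1 / p' = 1" "banach_space E"
    and norming: "\<And>x. x \<in> carr E \<Longrightarrow> \<exists>f\<in>dual_ball E. f x = nrm E x"
  shows "multinormed_space p (min_mn p E)"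
proof (rule multinormed_spaceI [OF assms(1)])
  note E = banach_space_normed [OF assms(2)]
  have tensor_min: "tensor_carr n (min_mn p E) = tensor_carr n E" for n
    by (simp add: tensor_carr_def)
  note upper = tnrm_min_mn_upper [OF assms(1) E]
  note least = tnrm_min_mn_least [OF assms(1) _ E]
  have dualE: "linear_map E scalars f" "x \<in> carr E \<Longrightarrow> \<bar>f x\<bar> \<le> nrm E x" if "f \<in> dual_ball E" for f x
    using that by (auto simp: dual_ball_iff [OF E])
  have dual_ellp: "linear_map (ellp p n) scalars a" "x \<in> carr (ellp p n) \<Longrightarrow> \<bar>a x\<bar> \<le> nrm (ellp p n) x"
    if "a \<in> dual_ball (ellp p n)" "1 \<le> n" for a n x
    using that(1) by (auto simp: dual_ball_iff [OF normed_space_ellp [OF assms(1) that(2)]])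
  show "banach_space (min_mn p E)"
    using assms(2) by (simp add: banach_space_def normed_space_def)
  have dual_min: "dual_ball (min_mn p E) = dual_ball E"
    by (simp add: dual_ball_def bounded_maps_def linear_map_def op_norm_def)
  {
    fix n :: nat
    assume n: "1 \<le> n"
    note ellp = normed_space_ellp [OF assms(1) n]
    \<comment> \<open>Only this half of homogeneity is read off the supremum; equality for nonzero c
      follows by applying it to c w with the scalar 1 / c.\<close>
    have scale_le: "tnrm (min_mn p E) n (c *\<^sub>R w) \<le> \<bar>c\<bar> * tnrm (min_mn p E) n w"
      if w: "w \<in> tensor_carr n E" for c w
      by (intro least [OF n])
        (simp add: tensor_pairing_scale [OF dualE(1) E w] abs_mult mult_left_mono upper [OF w])
    show "normed_space (tensor_space n (min_mn p E))"
      unfolding normed_space_def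
    proof (intro conjI ballI allI; simp only: tensor_space_simps tensor_min)
      show "subspace (tensor_carr n E)"
        by (rule subspace_tensor_carr [OF E])
    next
      fix w
      assume w: "w \<in> tensor_carr n E"
      show nonneg: "0 \<le> tnrm (min_mn p E) n w"
        by (rule tnrm_min_mn_nonneg [OF assms(1) n E w])
      show "tnrm (min_mn p E) n w = 0 \<longleftrightarrow> w = 0"
      proof
        assume 0: "tnrm (min_mn p E) n w = 0"
        show "w = 0"
        proof
          fix k
          show "w k = 0 k"
          proof (cases "k < n")
            case True
            obtain f where f: "f \<in> dual_ball E" "f (w k) = nrm E (w k)"
              using norming tensor_carr_mem [OF E w] by blast
            \<comment> \<open>The k-th coordinate functional isolates the component
              \<open>w k\<close>, whose norm f reads off.\<close>
            have "(\<lambda>x. x k) \<in> dual_ball (ellp p n)"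
              using ellp_coordinate [OF assms(1) True]
              by (auto simp: dual_ball_iff [OF ellp] linear_map_def scaleR_fun_def)
            from upper [OF w this f(1)] have "tensor_pairing n (\<lambda>x. x k) f w = 0"
              using 0 by simp
            moreover have "tensor_pairing n (\<lambda>x. x k) f w = (\<Sum>j<n. if k = j then f (w j) else 0)"
              unfolding tensor_pairing_def by (intro sum.cong) (auto simp: unit_vec_def)
            ultimately have "nrm E (w k) = 0"
              using True f(2) by simp
            then show ?thesis
              using normed_space_eq_0 [OF E tensor_carr_mem [OF E w]] by simp
          qed (use tensor_carr_0 [OF w] in simp)
        qed
      next
        assume "w = 0"
        then show "tnrm (min_mn p E) n w = 0"
          using scale_le [OF w, of 0] nonneg by simp
      qed
      fix c
      show "tnrm (min_mn p E) n (c *\<^sub>R w) = \<bar>c\<bar> * tnrm (min_mn p E) n w"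
      proof (cases "c = 0")
        case True
        then show ?thesis
          using scale_le [OF w, of 0] tnrm_min_mn_nonneg [OF assms(1) n E, of 0]
            subspace_0 [OF subspace_tensor_carr [OF E]] by auto
      next
        case False
        have "tnrm (min_mn p E) n w \<le> \<bar>1 / c\<bar> * tnrm (min_mn p E) n (c *\<^sub>R w)"
          using scale_le [OF subspace_scale [OF subspace_tensor_carr [OF E] w], of "1 / c" c] False by simp
        then show ?thesis
          using scale_le [OF w, of c] False by (simp add: field_simps)
      qed
    next
      fix w w'
      assume w: "w \<in> tensor_carr n E" "w' \<in> tensor_carr n E"
      show "tnrm (min_mn p E) n (w + w') \<le> tnrm (min_mn p E) n w + tnrm (min_mn p E) n w'"
      proof (rule least [OF n])
        fix a f
        assume af: "a \<in> dual_ball (ellp p n)" "f \<in> dual_ball E"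
        show "\<bar>tensor_pairing n a f (w + w')\<bar> \<le> tnrm (min_mn p E) n w + tnrm (min_mn p E) n w'"
          using upper [OF w(1) af] upper [OF w(2) af] tensor_pairing_add [OF dualE(1) [OF af(2)] E w]
          by (smt (verit))
      qed
    qed
    show "tnrm (min_mn p E) n (elem_tensor a x) = nrm (ellp p n) a * nrm (min_mn p E) x"
      if a: "a \<in> carr (ellp p n)" and x: "x \<in> carr (min_mn p E)" for a x
    proof -
      from x have x: "x \<in> carr E" by simp
      have pairing: "tensor_pairing n b f (elem_tensor a x) = b a * f x"
        if "b \<in> dual_ball (ellp p n)" "f \<in> dual_ball E" for b f
        using tensor_pairing_elem [OF ellp dual_ellp(1) [OF that(1) n] dualE(1) [OF that(2)] a x] .
      have "tnrm (min_mn p E) n (elem_tensor a x) \<le> nrm (ellp p n) a * nrm E x"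
      proof (rule least [OF n])
        fix b f
        assume bf: "b \<in> dual_ball (ellp p n)" "f \<in> dual_ball E"
        show "\<bar>tensor_pairing n b f (elem_tensor a x)\<bar> \<le> nrm (ellp p n) a * nrm E x"
          unfolding pairing [OF bf] abs_mult
          by (intro mult_mono dual_ellp(2) [OF bf(1) n a] dualE(2) [OF bf(2) x] ellp_nonneg [OF n]) simp
      qed
      moreover obtain b f where bf: "b \<in> dual_ball (ellp p n)" "b a = nrm (ellp p n) a"
        "f \<in> dual_ball E" "f x = nrm E x"
        using ellp_norming [OF assms(1) n] norming [OF x] by metis
      then have "nrm (ellp p n) a * nrm E x \<le> tnrm (min_mn p E) n (elem_tensor a x)"
        using upper [OF elem_tensor_carr [OF E a x] bf(1,3)] pairing [OF bf(1,3)] by simp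
      ultimately show ?thesis by simp
    qed
    show "\<bar>tensor_pairing n a f w\<bar> \<le> tnrm (min_mn p E) n w"
      if "w \<in> tensor_carr n (min_mn p E)" "a \<in> dual_ball (ellp p n)" "f \<in> dual_ball (min_mn p E)" for a f w
      using that upper by (simp add: tensor_min dual_min)
    fix m T c w
    assume m: "1 \<le> m" and T: "linear_map (ellp p n) (ellp p m) T"
      and c: "0 \<le> c" "\<And>x. x \<in> carr (ellp p n) \<Longrightarrow> nrm (ellp p m) (T x) \<le> c * nrm (ellp p n) x"
      and "w \<in> tensor_carr n (min_mn p E)"
    then have w: "w \<in> tensor_carr n E"
      by (simp add: tensor_min)
    show "tnrm (min_mn p E) m (tensor_left n T w) \<le> c * tnrm (min_mn p E) n w"
    proof (rule least [OF m])
      fix a f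
      assume af: "a \<in> dual_ball (ellp p m)" "f \<in> dual_ball E"
      have "\<bar>tensor_pairing n (\<lambda>x. a (T x)) f w\<bar> \<le> c * 1 * tnrm (min_mn p E) n w"
      proof (rule tensor_pairing_le_min_mn [OF assms(1) n E w])
        show "linear_map (ellp p n) scalars (\<lambda>x. a (T x))"
          by (rule linear_map_compose [OF T dual_ellp(1) [OF af(1) m]])
        show "\<bar>a (T x)\<bar> \<le> c * nrm (ellp p n) x" if "x \<in> carr (ellp p n)" for x
          using dual_ellp(2) [OF af(1) m linear_map_carr [OF T that]] c(2) [OF that] by linarith
      qed (use c(1) dualE [OF af(2)] in auto)
      then show "\<bar>tensor_pairing m a f (tensor_left n T w)\<bar> \<le> c * tnrm (min_mn p E) n w"
        using tensor_pairing_left [OF normed_space_ellp [OF assms(1) m] dual_ellp(1) [OF af(1) m] T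
            dualE(1) [OF af(2)] E w] by simp
    qed
  }
qed

section \<open>Tensors as operators; projectivity of the summands\<close>

lemma tnrm_min_mn_identity:
  assumes "1 / p + 1 / p' = 1" "1 \<le> N"
  shows "tnrm (min_mn p (ellp p' N)) N (\<lambda>k. if k < N then unit_vec k else 0) \<le> 1"
proof (rule tnrm_min_mn_least [OF assms normed_space_ellp [OF conjugate_commute [OF assms(1)] assms(2)]])
  fix a f
  assume a: "a \<in> dual_ball (ellp p N)" and f: "f \<in> dual_ball (ellp p' N)"
  note ellp = normed_space_ellp [OF assms]
  have a': "linear_map (ellp p N) scalars a" "\<And>x. x \<in> carr (ellp p N) \<Longrightarrow> \<bar>a x\<bar> \<le> nrm (ellp p N) x"
    using a dual_ball_iff [OF ellp] by auto
  \<comment> \<open>Pairing the tensor of the identity with a and f evaluates a at the coefficient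
    vector of f. By duality this vector lies in the unit ball of l^p_N, since f lies in the dual
    ball of l^p'_N.\<close>
  let ?b = "\<lambda>k. if k < N then f (unit_vec k) else 0"
  have b: "?b \<in> carr (ellp p N)" by simp
  have "tensor_pairing N a f (\<lambda>k. if k < N then unit_vec k else 0) = a ?b"
    using linear_map_ellp_expansion [OF ellp a'(1) b] by (simp add: tensor_pairing_def mult.commute)
  then show "\<bar>tensor_pairing N a f (\<lambda>k. if k < N then unit_vec k else 0)\<bar> \<le> 1"
    using a'(2) [OF b] dual_ball_ellp [OF conjugate_commute [OF assms(1)] assms(2) f] by linarith
qed

text \<open>The operator has the matrix entries \<open>w j k\<close>. A functional a that norms the
  image of x turns its norm into the pairing of w with a and with the functional on l^p'_N given by
  x, which Hoelder bounds by the norm of x.\<close>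

lemma ellp_operator_bound:
  assumes "1 / p + 1 / p' = 1" "1 \<le> N" "1 \<le> n" "w \<in> tensor_carr n (ellp p' N)"
  shows "linear_map (ellp p N) (ellp p n) (\<lambda>x j. \<Sum>k<N. x k * w j k)"
    and "nrm (ellp p n) (\<lambda>j. \<Sum>k<N. x k * w j k) \<le> tnrm (min_mn p (ellp p' N)) n w * nrm (ellp p N) x"
proof -
  note p' = conjugate_commute [OF assms(1)]
  note ellp' = normed_space_ellp [OF p' assms(2)]
  have carr: "(\<lambda>j. \<Sum>k<N. x k * w j k) \<in> carr (ellp p n)" for x
    using tensor_carr_0 [OF assms(4)] by simp
  with tensor_carr_mem [OF ellp' assms(4)]
  show "linear_map (ellp p N) (ellp p n) (\<lambda>x j. \<Sum>k<N. x k * w j k)"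
    by (auto simp: linear_map_def sum.distrib algebra_simps scaleR_fun_def sum_distrib_left)
  obtain a where a: "a \<in> dual_ball (ellp p n)"
    "a (\<lambda>j. \<Sum>k<N. x k * w j k) = nrm (ellp p n) (\<lambda>j. \<Sum>k<N. x k * w j k)"
    using ellp_norming [OF assms(1,3)] by blast
  have a': "linear_map (ellp p n) scalars a" "\<And>x. x \<in> carr (ellp p n) \<Longrightarrow> \<bar>a x\<bar> \<le> 1 * nrm (ellp p n) x"
    using a(1) dual_ball_iff [OF normed_space_ellp [OF assms(1,3)]] by auto
  define f where "f z = (\<Sum>k<N. z k * x k)" for z
  have "\<bar>tensor_pairing n a f w\<bar> \<le> 1 * nrm (ellp p N) x * tnrm (min_mn p (ellp p' N)) n w"
    unfolding f_def
    by (intro tensor_pairing_le_min_mn [OF assms(1,3) ellp' assms(4) a'] ellp_functional [OF p' assms(2) order_refl]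
        ellp_nonneg [OF assms(2)]) simp_all
  moreover have "tensor_pairing n a f w = a (\<lambda>j. \<Sum>k<N. x k * w j k)"
    using linear_map_ellp_expansion [OF normed_space_ellp [OF assms(1,3)] a'(1) carr]
    by (simp add: tensor_pairing_def f_def mult.commute)
  ultimately show "nrm (ellp p n) (\<lambda>j. \<Sum>k<N. x k * w j k) \<le> tnrm (min_mn p (ellp p' N)) n w * nrm (ellp p N) x"
    using a(2) by (simp add: mult.commute)
qed

proposition one_projective_min_mn_ellp:
  fixes p p' :: ennreal
  assumes "1 / p + 1 / p' = 1" "1 \<le> N"
  shows "one_projective TYPE('y::real_vector) TYPE('x::real_vector) p (min_mn p (ellp p' N))"
  unfolding one_projective_def
proof (intro conjI allI impI)
  note p' = conjugate_commute [OF assms(1)]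
  note ellp' = normed_space_ellp [OF p' assms(2)]
  let ?Z = "min_mn p (ellp p' N)"
  show mZ: "multinormed_space p ?Z"
    using multinormed_min_mn [OF assms(1) banach_space_ellp [OF p' assms(2)]] ellp_norming [OF p' assms(2)]
    by blast
  fix \<epsilon> :: real and Y :: "'y mnspace" and X :: "'x mnspace" and q u
  assume "\<epsilon> > 0" and mY: "multinormed_space p Y" and mX: "multinormed_space p X"
    and q: "multi_quotient Y X q" and u: "multibounded ?Z X u"
  note Y = multinormed_normed [OF mY]
  from u obtain c where c: "0 \<le> c" "multibound ?Z X u = ennreal c" and lin: "linear_map ?Z X u"
    and bound: "\<And>n w. 1 \<le> n \<Longrightarrow> w \<in> tensor_carr n ?Z \<Longrightarrow> tnrm X n (tensor_right u w) \<le> c * tnrm ?Z n w"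
    by (rule multiboundedE [OF _ mZ mX]) blast
  have tensor_Z: "tensor_carr n ?Z = tensor_carr n (ellp p' N)" for n
    by (simp add: tensor_carr_def)
  \<comment> \<open>J is the sum of the tensors e_k (x) e_k over k < N. The components of (I (x) u)
    J are the values of u on the unit vectors, so this one tensor determines u.\<close>
  define J :: "nat \<Rightarrow> nat \<Rightarrow> real" where "J = (\<lambda>k. if k < N then unit_vec k else 0)"
  have J: "J \<in> tensor_carr N ?Z"
    by (auto simp: tensor_carr_def J_def unit_vec_def)
  have "tnrm ?Z N J \<le> 1"
    unfolding J_def by (rule tnrm_min_mn_identity [OF assms])
  then have "tnrm X N (tensor_right u J) \<le> c"
    using bound [OF assms(2) J] mult_left_le [OF _ c(1)] by (meson order_trans)
  \<comment> \<open>The gap \<epsilon> supplies the strict inequality that lifting through open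
    balls requires, also when c = 0.\<close>
  then have "tnrm X N (tensor_right u J) < c + \<epsilon>"
    using \<open>\<epsilon> > 0\<close> by linarith
  then obtain V where V: "V \<in> tensor_carr N Y" "tensor_right q V = tensor_right u J" "tnrm Y N V < c + \<epsilon>"
    using multi_quotient_lift [OF q mY mX assms(2) tensor_right_carr [OF lin multinormed_normed [OF mZ] J]]
    by blast
  have linq: "linear_map Y X q"
    using q by (simp add: multi_quotient_def)
  \<comment> \<open>v is linear and sends e_k to \<open>V k\<close>, so q v = u only has to be
    compared on unit vectors.\<close>
  define v where "v z = (\<Sum>k<N. z k *\<^sub>R V k)" for z
  note V_mem = tensor_carr_mem [OF Y V(1)]
  have linv: "linear_map ?Z Y v"
    using V_mem
    by (auto simp: linear_map_def v_def scaleR_fun_def algebra_simps sum.distrib scaleR_sum_right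
        intro!: normed_space_sum [OF Y] normed_space_scaleR [OF Y])
  have "q (v z) = u z" if z: "z \<in> carr ?Z" for z
  proof -
    have qV: "q (V k) = u (unit_vec k)" if "k < N" for k
      using fun_cong [OF V(2), of k] that by (simp add: tensor_right_def J_def)
    have lin': "linear_map (ellp p' N) X u"
      using lin by (simp add: linear_map_def)
    have "q (v z) = (\<Sum>k<N. q (z k *\<^sub>R V k))"
      unfolding v_def by (intro linear_map_sum [OF linq Y] normed_space_scaleR [OF Y] V_mem)
    also have "\<dots> = (\<Sum>k<N. z k *\<^sub>R u (unit_vec k))"
      using V_mem by (intro sum.cong) (auto simp: linear_map_scale [OF linq] qV)
    also have "\<dots> = u z"
      using z by (intro linear_map_ellp_expansion [OF ellp' lin', symmetric]) simp
    finally show ?thesis .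
  qed
  moreover have "multibound ?Z Y v \<le> ennreal (c + \<epsilon>)"
    unfolding multibound_le_iff [OF mZ mY linv add_nonneg_nonneg [OF c(1) less_imp_le [OF \<open>\<epsilon> > 0\<close>]]]
  proof (intro allI impI ballI)
    fix n w
    assume n: "1 \<le> n" and "w \<in> tensor_carr n ?Z"
    then have w: "w \<in> tensor_carr n (ellp p' N)" "0 \<le> tnrm ?Z n w"
      using tnrm_min_mn_nonneg [OF assms(1) n ellp'] by (simp_all add: tensor_Z)
    have "tnrm Y n (tensor_left N (\<lambda>x j. \<Sum>k<N. x k * w j k) V) \<le> tnrm ?Z n w * tnrm Y N V"
      by (intro multinormed_left [OF mY assms(1) n assms(2)] ellp_operator_bound [OF assms n w(1)] V(1) w(2))
    also have "\<dots> \<le> tnrm ?Z n w * (c + \<epsilon>)"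
      using V(3) w(2) by (intro mult_left_mono) auto
    \<comment> \<open>The operator given by w maps e_l to the tuple of all \<open>w j l\<close>, so
      applied to V it has j-th component v (w j).\<close>
    also have "tensor_left N (\<lambda>x j. \<Sum>k<N. x k * w j k) V = tensor_right v w"
    proof
      fix j
      have "(\<Sum>k<N. unit_vec l k * w j k) = w j l" if "l < N" for l
        using that by (simp add: unit_vec_def if_distrib [where f = "\<lambda>x. x * _"] cong: if_cong)
      then show "tensor_left N (\<lambda>x j. \<Sum>k<N. x k * w j k) V j = tensor_right v w j"
        by (simp add: tensor_left_apply tensor_right_def v_def)
    qed
    finally show "tnrm Y n (tensor_right v w) \<le> (c + \<epsilon>) * tnrm ?Z n w"
      by (simp add: mult.commute)
  qed
  ultimately show "\<exists>v. linear_map ?Z Y v \<and> multibound ?Z Y v \<le> multibound ?Z X u + ennreal \<epsilon> \<and>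
      (\<forall>z\<in>carr ?Z. q (v z) = u z)"
    using linv c \<open>\<epsilon> > 0\<close> by (intro exI [of _ v]) (simp add: ennreal_plus)
qed

section \<open>Unordered sums\<close>

text \<open>The components \<pi> are abstract because the lemma serves twice: for the l^1 sum
  itself, where \<pi> i z is z i, and for its tensor products with l^p_n, where \<pi> i w is the
  tuple of i-th components.\<close>

lemma normed_space_infsum:
  fixes G :: "('a::real_vector, 'm) nspace_scheme" and F :: "'i \<Rightarrow> ('b::real_vector, 'k) nspace_scheme"
  assumes "\<And>i. i \<in> I \<Longrightarrow> normed_space (F i)" "subspace (carr G)"
    "\<And>i z. i \<in> I \<Longrightarrow> z \<in> carr G \<Longrightarrow> \<pi> i z \<in> carr (F i)"
    "\<And>i z z'. \<pi> i (z + z') = \<pi> i z + \<pi> i z'" "\<And>i c z. \<pi> i (c *\<^sub>R z) = c *\<^sub>R \<pi> i z"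
    "\<And>z. z \<in> carr G \<Longrightarrow> (\<And>i. i \<in> I \<Longrightarrow> \<pi> i z = 0) \<Longrightarrow> z = 0"
    "\<And>z. z \<in> carr G \<Longrightarrow> (\<lambda>i. nrm (F i) (\<pi> i z)) summable_on I"
    "\<And>z. z \<in> carr G \<Longrightarrow> nrm G z = (\<Sum>\<^sub>\<infinity>i\<in>I. nrm (F i) (\<pi> i z))"
  shows "normed_space G"
  unfolding normed_space_def
proof (intro conjI ballI allI assms(2))
  fix z
  assume z: "z \<in> carr G"
  have nonneg: "0 \<le> nrm (F i) (\<pi> i z)" if "i \<in> I" for i
    using normed_space_nonneg [OF assms(1) [OF that] assms(3) [OF that z]] .
  then show "0 \<le> nrm G z"
    unfolding assms(8) [OF z] by (rule infsum_nonneg)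
  show "nrm G z = 0 \<longleftrightarrow> z = 0"
  proof
    assume "nrm G z = 0"
    then have "nrm (F i) (\<pi> i z) = 0" if "i \<in> I" for i
      using nonneg_infsum_le_0D [OF _ assms(7) [OF z] nonneg that] assms(8) [OF z] by simp
    then show "z = 0"
      using assms(6) [OF z] normed_space_eq_0 [OF assms(1) assms(3) [OF _ z]] by blast
  next
    assume "z = 0"
    have "\<pi> i 0 = 0" for i
      using assms(5) [of i 0 0] by simp
    then show "nrm G z = 0"
      unfolding assms(8) [OF z] by (intro infsum_0) (simp add: \<open>z = 0\<close> normed_space_nrm_0 assms(1))
  qed
  show "nrm G (c *\<^sub>R z) = \<bar>c\<bar> * nrm G z" for c
    unfolding assms(8) [OF z] assms(8) [OF subspace_scale [OF assms(2) z]]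
    using normed_space_scale [OF assms(1) assms(3) [OF _ z]]
    by (simp add: assms(5) flip: infsum_cmult_right' cong: infsum_cong)
  fix z'
  assume z': "z' \<in> carr G"
  have zz': "z + z' \<in> carr G"
    by (rule subspace_add [OF assms(2) z z'])
  have "nrm G (z + z') \<le> (\<Sum>\<^sub>\<infinity>i\<in>I. nrm (F i) (\<pi> i z) + nrm (F i) (\<pi> i z'))"
    unfolding assms(8) [OF zz']
    using normed_space_triangle [OF assms(1) assms(3) [OF _ z] assms(3) [OF _ z']]
    by (intro infsum_mono assms(7) [OF zz'] summable_on_add assms(7) [OF z] assms(7) [OF z'])
      (simp add: assms(4))
  also have "\<dots> = nrm G z + nrm G z'"
    by (simp add: assms(8) [OF z] assms(8) [OF z'] infsum_add assms(7) [OF z] assms(7) [OF z'])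
  finally show "nrm G (z + z') \<le> nrm G z + nrm G z'" .
qed

text \<open>Spaces are carriers with a norm, not topological types, so convergence is expressed
  through the norm of the remainder. It runs along finite subsets, without an ordering of I, because
  I may be uncountable.\<close>

definition has_nsum ::
  "('a::real_vector, 'm) nspace_scheme \<Rightarrow> ('i \<Rightarrow> 'a) \<Rightarrow> 'i set \<Rightarrow> 'a \<Rightarrow> bool" where
  "has_nsum E g I s \<longleftrightarrow>
     s \<in> carr E \<and> ((\<lambda>F. nrm E (s - sum g F)) \<longlongrightarrow> 0) (finite_subsets_at_top I)"

text \<open>Used with c the difference of two sides of an inequality that holds at each finite stage
  up to the error \<open>r F\<close>; in the limit the error disappears.\<close>

lemma tendsto_0_finite_subsets_bound:
  assumes "(r \<longlongrightarrow> (0::real)) (finite_subsets_at_top I)"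
    "\<And>F. finite F \<Longrightarrow> F \<subseteq> I \<Longrightarrow> c \<le> r F"
  shows "c \<le> 0"
  by (rule tendsto_lowerbound [OF assms(1)]) (auto intro: assms(2))

lemma has_nsum_unique:
  assumes "normed_space E" "\<And>i. i \<in> I \<Longrightarrow> g i \<in> carr E" "has_nsum E g I s" "has_nsum E g I s'"
  shows "s = s'"
proof -
  have s: "s \<in> carr E" "s' \<in> carr E"
    using assms(3,4) by (auto simp: has_nsum_def)
  have "nrm E (s - s') \<le> 0"
  proof (rule tendsto_0_finite_subsets_bound)
    show "((\<lambda>F. nrm E (s - sum g F) + nrm E (s' - sum g F)) \<longlongrightarrow> 0) (finite_subsets_at_top I)"
      using assms(3,4) by (intro tendsto_add_zero) (auto simp: has_nsum_def)
    fix F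
    assume "F \<subseteq> I"
    then have F: "sum g F \<in> carr E"
      using assms(2) by (intro normed_space_sum [OF assms(1)]) auto
    show "nrm E (s - s') \<le> nrm E (s - sum g F) + nrm E (s' - sum g F)"
      using normed_space_triangle_diff [OF assms(1) s(1) F s(2)] normed_space_minus_commute [OF assms(1) s(2) F]
      by simp
  qed
  then have "s - s' = 0"
    using normed_space_eq_0 [OF assms(1) normed_space_diff [OF assms(1) s]]
      normed_space_nonneg [OF assms(1) normed_space_diff [OF assms(1) s]] by linarith
  then show ?thesis by simp
qed

lemma tendsto_0_finite_subsets_le:
  assumes "(r \<longlongrightarrow> (0::real)) (finite_subsets_at_top I)"
    "\<And>F. finite F \<Longrightarrow> F \<subseteq> I \<Longrightarrow> 0 \<le> h F" "\<And>F. finite F \<Longrightarrow> F \<subseteq> I \<Longrightarrow> h F \<le> r F"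
  shows "(h \<longlongrightarrow> 0) (finite_subsets_at_top I)"
  by (rule tendsto_sandwich [OF _ _ tendsto_const assms(1)]) (auto intro: assms(2,3))

lemma has_nsum_add:
  assumes "normed_space E" "\<And>i. i \<in> I \<Longrightarrow> g i \<in> carr E" "\<And>i. i \<in> I \<Longrightarrow> h i \<in> carr E"
    "has_nsum E g I s" "has_nsum E h I t"
  shows "has_nsum E (\<lambda>i. g i + h i) I (s + t)"
  unfolding has_nsum_def
proof
  have st: "s \<in> carr E" "t \<in> carr E"
    using assms(4,5) by (auto simp: has_nsum_def)
  then show "s + t \<in> carr E"
    by (rule normed_space_add [OF assms(1)])
  have F: "sum g F \<in> carr E" "sum h F \<in> carr E" if "F \<subseteq> I" for F
    using assms(2,3) that by (auto intro!: normed_space_sum [OF assms(1)])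
  show "((\<lambda>F. nrm E (s + t - (\<Sum>i\<in>F. g i + h i))) \<longlongrightarrow> 0) (finite_subsets_at_top I)"
  proof (rule tendsto_0_finite_subsets_le)
    show "((\<lambda>F. nrm E (s - sum g F) + nrm E (t - sum h F)) \<longlongrightarrow> 0) (finite_subsets_at_top I)"
      using assms(4,5) by (intro tendsto_add_zero) (auto simp: has_nsum_def)
    fix F
    assume "F \<subseteq> I"
    note F = F [OF this]
    have eq: "s + t - (\<Sum>i\<in>F. g i + h i) = (s - sum g F) + (t - sum h F)"
      by (simp add: sum.distrib)
    note d = normed_space_diff [OF assms(1) st(1) F(1)] normed_space_diff [OF assms(1) st(2) F(2)]
    show "0 \<le> nrm E (s + t - (\<Sum>i\<in>F. g i + h i))"
      unfolding eq by (rule normed_space_nonneg [OF assms(1) normed_space_add [OF assms(1) d]])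
    show "nrm E (s + t - (\<Sum>i\<in>F. g i + h i)) \<le> nrm E (s - sum g F) + nrm E (t - sum h F)"
      unfolding eq by (rule normed_space_triangle [OF assms(1) d])
  qed
qed

text \<open>Allows functionals, scalar multiplication, u and q to be applied to unordered sums term
  by term.\<close>

lemma has_nsum_linear_map:
  assumes "normed_space E" "normed_space F" "linear_map E F T"
    "\<And>x. x \<in> carr E \<Longrightarrow> nrm F (T x) \<le> c * nrm E x"
    "\<And>i. i \<in> I \<Longrightarrow> g i \<in> carr E" "has_nsum E g I s"
  shows "has_nsum F (\<lambda>i. T (g i)) I (T s)"
  unfolding has_nsum_def
proof
  have s: "s \<in> carr E"
    using assms(6) by (simp add: has_nsum_def)
  then show "T s \<in> carr F"
    by (rule linear_map_carr [OF assms(3)])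
  show "((\<lambda>A. nrm F (T s - (\<Sum>i\<in>A. T (g i)))) \<longlongrightarrow> 0) (finite_subsets_at_top I)"
  proof (rule tendsto_0_finite_subsets_le)
    show "((\<lambda>A. c * nrm E (s - sum g A)) \<longlongrightarrow> 0) (finite_subsets_at_top I)"
      using assms(6) by (intro tendsto_mult_right_zero) (simp add: has_nsum_def)
    fix A
    assume "A \<subseteq> I"
    then have g: "g i \<in> carr E" if "i \<in> A" for i
      using assms(5) that by blast
    have A: "sum g A \<in> carr E"
      by (rule normed_space_sum [OF assms(1) g])
    have "T (sum g A) = (\<Sum>i\<in>A. T (g i))"
      by (rule linear_map_sum [OF assms(3,1) g])
    then have eq: "T s - (\<Sum>i\<in>A. T (g i)) = T (s - sum g A)"
      using linear_map_diff [OF assms(3,1) s A] by simp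
    note d = normed_space_diff [OF assms(1) s A]
    show "0 \<le> nrm F (T s - (\<Sum>i\<in>A. T (g i)))"
      unfolding eq by (rule normed_space_nonneg [OF assms(2) linear_map_carr [OF assms(3) d]])
    show "nrm F (T s - (\<Sum>i\<in>A. T (g i))) \<le> c * nrm E (s - sum g A)"
      unfolding eq by (rule assms(4) [OF d])
  qed
qed

text \<open>Completeness speaks of sequences, the sum is a limit of a net. So finite sets
  \<open>F n\<close> are chosen outside of which every finite sum of norms is at most \<epsilon> n;
  the sums over them form a Cauchy sequence, and its limit is also the limit of the net.\<close>

lemma has_nsum_exists:
  assumes "banach_space E" "\<And>i. i \<in> I \<Longrightarrow> g i \<in> carr E" "(\<lambda>i. nrm E (g i)) summable_on I"
  shows "\<exists>s. has_nsum E g I s"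
proof -
  note E = banach_space_normed [OF assms(1)]
  let ?h = "\<lambda>i. nrm E (g i)"
  have nonneg: "0 \<le> ?h i" if "i \<in> I" for i
    using normed_space_nonneg [OF E assms(2) [OF that]] .
  define \<epsilon> :: "nat \<Rightarrow> real" where "\<epsilon> n = 1 / Suc n" for n
  have \<epsilon>_pos: "\<epsilon> n > 0" for n
    by (simp add: \<epsilon>_def)
  have \<epsilon>_lim: "\<epsilon> \<longlonglongrightarrow> 0"
    unfolding \<epsilon>_def by (rule lim_1_over_n [THEN LIMSEQ_Suc])
  have "\<exists>F. finite F \<and> F \<subseteq> I \<and> (\<forall>A. finite A \<longrightarrow> A \<subseteq> I - F \<longrightarrow> sum ?h A \<le> \<epsilon> n)" for n
  proof -
    obtain F where F: "finite F" "F \<subseteq> I" "dist (sum ?h F) (infsum ?h I) \<le> \<epsilon> n"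
      using infsum_finite_approximation [OF assms(3) \<epsilon>_pos] by blast
    have "sum ?h A \<le> \<epsilon> n" if A: "finite A" "A \<subseteq> I - F" for A
    proof -
      have "sum ?h F + sum ?h A = sum ?h (F \<union> A)"
        using F A by (intro sum.union_disjoint [symmetric]) auto
      also have "\<dots> \<le> infsum ?h I"
        using F A nonneg by (intro finite_sum_le_infsum assms(3)) auto
      finally show ?thesis
        using F(3) by (simp add: dist_real_def)
    qed
    with F show ?thesis by blast
  qed
  then obtain F where F: "\<And>n. finite (F n)" "\<And>n. F n \<subseteq> I"
    "\<And>n A. finite A \<Longrightarrow> A \<subseteq> I - F n \<Longrightarrow> sum ?h A \<le> \<epsilon> n"
    by metis
  have mem: "sum g A \<in> carr E" if "A \<subseteq> I" for A
    using assms(2) that by (intro normed_space_sum [OF E]) auto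
  have sum_le: "nrm E (sum g A) \<le> sum ?h A" if "A \<subseteq> I" for A
    using assms(2) that by (intro normed_space_sum_le [OF E]) auto
  \<comment> \<open>The sets \<open>F n\<close> need not be nested. The sum over the common part
    cancels, and for A = \<open>F m\<close>, B = \<open>F n\<close> both differences are
    tails.\<close>
  have diff_le: "nrm E (sum g A - sum g B) \<le> sum ?h (A - B) + sum ?h (B - A)"
    if AB: "finite A" "finite B" "A \<subseteq> I" "B \<subseteq> I" for A B
  proof -
    have sub: "A - B \<subseteq> I" "B - A \<subseteq> I" "A \<inter> B \<subseteq> I"
      using AB by auto
    have "sum g A = sum g (A - B) + sum g (A \<inter> B)" "sum g B = sum g (B - A) + sum g (A \<inter> B)"
      using sum.Int_Diff [OF AB(1), of g B] sum.Int_Diff [OF AB(2), of g A]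
      by (simp_all add: Int_commute add.commute)
    then have "nrm E (sum g A - sum g B) = nrm E (sum g (A - B) - sum g (B - A))"
      by simp
    also have "\<dots> \<le> nrm E (sum g (A - B)) + nrm E (sum g (B - A))"
      using normed_space_triangle_diff [OF E mem [OF sub(1)] normed_space_0 [OF E] mem [OF sub(2)]]
        normed_space_minus_commute [OF E normed_space_0 [OF E] mem [OF sub(2)]] by simp
    finally show ?thesis
      using sum_le [OF sub(1)] sum_le [OF sub(2)] by linarith
  qed
  let ?s = "\<lambda>n. sum g (F n)"
  have dist_le: "nrm E (?s m - ?s n) \<le> \<epsilon> m + \<epsilon> n" for m n
  proof -
    have "sum ?h (F m - F n) \<le> \<epsilon> n" "sum ?h (F n - F m) \<le> \<epsilon> m"
      by (rule F(3); use F(1,2) in blast)+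
    then show ?thesis
      using diff_le [OF F(1,1,2,2), of m n] by linarith
  qed
  have "\<forall>e>0. \<exists>N. \<forall>i\<ge>N. \<forall>j\<ge>N. nrm E (?s i - ?s j) < e"
  proof (intro allI impI)
    fix e :: real
    assume "e > 0"
    then have "\<forall>\<^sub>F n in sequentially. \<epsilon> n < e / 2"
      by (intro order_tendstoD(2) [OF \<epsilon>_lim]) simp
    then obtain N where N: "\<And>n. n \<ge> N \<Longrightarrow> \<epsilon> n < e / 2"
      by (auto simp: eventually_sequentially)
    have "nrm E (?s i - ?s j) < e" if "N \<le> i" "N \<le> j" for i j
      using dist_le [of i j] N [OF that(1)] N [OF that(2)] by linarith
    then show "\<exists>N. \<forall>i\<ge>N. \<forall>j\<ge>N. nrm E (?s i - ?s j) < e"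
      by blast
  qed
  moreover have "range ?s \<subseteq> carr E"
    using mem [OF F(2)] by blast
  ultimately have "\<exists>s\<in>carr E. (\<lambda>n. nrm E (?s n - s)) \<longlonglongrightarrow> 0"
    using assms(1) unfolding banach_space_def by blast
  then obtain s where s: "s \<in> carr E" "(\<lambda>n. nrm E (?s n - s)) \<longlonglongrightarrow> 0"
    by blast
  have s_le: "nrm E (s - ?s n) \<le> \<epsilon> n" for n
  proof -
    \<comment> \<open>As m grows, the distance of \<open>?s m\<close> from s and \<epsilon> m
      vanish, and \<epsilon> n is left.\<close>
    have "nrm E (s - ?s n) \<le> nrm E (?s m - s) + (\<epsilon> m + \<epsilon> n)" for m
      using normed_space_triangle_diff [OF E s(1) mem [OF F(2)] mem [OF F(2)], of n m] dist_le [of m n]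
        normed_space_minus_commute [OF E s(1) mem [OF F(2)], of m] by linarith
    moreover have "(\<lambda>m. nrm E (?s m - s) + (\<epsilon> m + \<epsilon> n)) \<longlonglongrightarrow> 0 + (0 + \<epsilon> n)"
      by (intro tendsto_intros s(2) \<epsilon>_lim)
    ultimately show ?thesis
      by (intro LIMSEQ_le_const [where X = "\<lambda>m. nrm E (?s m - s) + (\<epsilon> m + \<epsilon> n)"]) auto
  qed
  \<comment> \<open>One \<epsilon> n for the distance from s to the sum over \<open>F n\<close>, one
    for the terms in A - \<open>F n\<close>.\<close>
  have near: "nrm E (s - sum g A) \<le> 2 * \<epsilon> n" if A: "finite A" "F n \<subseteq> A" "A \<subseteq> I" for A n
  proof -
    have "sum ?h (A - F n) \<le> \<epsilon> n"
      using A by (intro F(3)) auto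
    moreover have "F n - A = {}"
      using A(2) by blast
    then have "sum ?h (F n - A) = 0"
      by (simp only: sum.empty)
    ultimately have "nrm E (?s n - sum g A) \<le> \<epsilon> n"
      using diff_le [OF F(1) A(1) F(2) A(3), of n] by linarith
    then show ?thesis
      using normed_space_triangle_diff [OF E s(1) mem [OF F(2)] mem [OF A(3)], of n] s_le [of n] by linarith
  qed
  have "((\<lambda>A. nrm E (s - sum g A)) \<longlongrightarrow> 0) (finite_subsets_at_top I)"
  proof (rule tendstoI)
    fix e :: real
    assume "e > 0"
    then have "\<forall>\<^sub>F n in sequentially. \<epsilon> n < e / 2"
      by (intro order_tendstoD(2) [OF \<epsilon>_lim]) simp
    then obtain n where n: "\<epsilon> n < e / 2"
      by (auto simp: eventually_sequentially)
    show "\<forall>\<^sub>F A in finite_subsets_at_top I. dist (nrm E (s - sum g A)) 0 < e"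
      unfolding eventually_finite_subsets_at_top
    proof (intro exI [of _ "F n"] conjI allI impI F)
      fix A
      assume A: "finite A \<and> F n \<subseteq> A \<and> A \<subseteq> I"
      then have "0 \<le> nrm E (s - sum g A)"
        by (intro normed_space_nonneg [OF E] normed_space_diff [OF E] s(1) mem) auto
      then show "dist (nrm E (s - sum g A)) 0 < e"
        using near [of A n] A n by simp
    qed
  qed
  with s(1) show ?thesis
    by (auto simp: has_nsum_def)
qed

section \<open>The \<open>\<ell>\<^sup>1\<close> sum\<close>

lemma l1_sum_simps [simp]:
  "nrm (l1_sum I X) z = (\<Sum>\<^sub>\<infinity>i\<in>I. nrm (X i) (z i))"
  "tnrm (l1_sum I X) n w = (\<Sum>\<^sub>\<infinity>i\<in>I. tnrm (X i) n (\<lambda>k. w k i))"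
  by (simp_all add: l1_sum_def)

lemma l1_sumD:
  assumes "z \<in> carr (l1_sum I X)"
  shows l1_sum_component: "i \<in> I \<Longrightarrow> z i \<in> carr (X i)"
    and l1_sum_outside: "i \<notin> I \<Longrightarrow> z i = 0"
    and l1_sum_summable: "(\<lambda>i. nrm (X i) (z i)) summable_on I"
  using assms by (auto simp: l1_sum_def)

lemma l1_sumI:
  "(\<And>i. i \<in> I \<Longrightarrow> z i \<in> carr (X i)) \<Longrightarrow> (\<And>i. i \<notin> I \<Longrightarrow> z i = 0) \<Longrightarrow>
    (\<lambda>i. nrm (X i) (z i)) summable_on I \<Longrightarrow> z \<in> carr (l1_sum I X)"
  by (simp add: l1_sum_def)

lemma summable_on_finite_sum:
  fixes f :: "'k \<Rightarrow> 'i \<Rightarrow> real"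
  assumes "\<And>k. f k summable_on I"
  shows "(\<lambda>i. \<Sum>k\<in>K. f k i) summable_on I"
  by (induction K rule: infinite_finite_induct) (auto intro: summable_on_add assms summable_on_0)

definition l1_single :: "'i \<Rightarrow> 'a::real_vector \<Rightarrow> 'i \<Rightarrow> 'a" where
  "l1_single i x = (\<lambda>j. if j = i then x else 0)"

lemma infsum_single_support:
  fixes f :: "'a \<Rightarrow> real"
  assumes "i \<in> I" "\<And>j. j \<in> I \<Longrightarrow> j \<noteq> i \<Longrightarrow> f j = 0"
  shows "f summable_on I" "infsum f I = f i"
  using has_sum_finite_neutralI [of "{i}" I f "f i"] assms
  by (auto simp: summable_on_def intro: infsumI)

lemma sum_l1_single:
  "finite F \<Longrightarrow> (\<Sum>i\<in>F. l1_single i (z i)) j = (if j \<in> F then z j else 0)"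
  by (simp add: sum_fun_apply l1_single_def)

locale normed_family =
  fixes I :: "'i set" and X :: "'i \<Rightarrow> 'a::real_vector mnspace"
  assumes X_normed: "i \<in> I \<Longrightarrow> normed_space (X i)"
begin

lemma subspace_l1_sum: "subspace (carr (l1_sum I X))"
  unfolding subspace_def
proof (intro conjI ballI allI)
  show "0 \<in> carr (l1_sum I X)"
    by (rule l1_sumI) (auto simp: normed_space_0 normed_space_nrm_0 X_normed intro!: summable_on_0)
next
  fix x y
  assume xy: "x \<in> carr (l1_sum I X)" "y \<in> carr (l1_sum I X)"
  note mem = l1_sum_component [OF xy(1)] l1_sum_component [OF xy(2)]
  show "x + y \<in> carr (l1_sum I X)"
  proof (rule l1_sumI)
    show "(\<lambda>i. nrm (X i) ((x + y) i)) summable_on I"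
      by (rule summable_on_comparison_test [OF summable_on_add [OF xy [THEN l1_sum_summable]]])
        (use mem in \<open>auto intro!: normed_space_triangle normed_space_nonneg normed_space_add simp: X_normed\<close>)
  qed (use mem l1_sum_outside [OF xy(1)] l1_sum_outside [OF xy(2)] in
      \<open>auto intro!: normed_space_add simp: X_normed\<close>)
next
  fix c x
  assume x: "x \<in> carr (l1_sum I X)"
  show "c *\<^sub>R x \<in> carr (l1_sum I X)"
  proof (rule l1_sumI)
    have "(\<lambda>i. nrm (X i) ((c *\<^sub>R x) i)) summable_on I \<longleftrightarrow> (\<lambda>i. \<bar>c\<bar> * nrm (X i) (x i)) summable_on I"
      using l1_sum_component [OF x]
      by (intro summable_on_cong) (simp add: scaleR_fun_def normed_space_scale X_normed)
    then show "(\<lambda>i. nrm (X i) ((c *\<^sub>R x) i)) summable_on I"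
      using summable_on_cmult_right [OF l1_sum_summable [OF x]] by simp
  qed (use l1_sum_component [OF x] l1_sum_outside [OF x] in
      \<open>auto intro!: normed_space_scaleR simp: X_normed scaleR_fun_def\<close>)
qed

lemma normed_space_l1_sum: "normed_space (l1_sum I X)"
proof (rule normed_space_infsum [where F = X and \<pi> = "\<lambda>i z. z i" and I = I])
  show "z = 0" if "z \<in> carr (l1_sum I X)" "\<And>i. i \<in> I \<Longrightarrow> z i = 0" for z
    using that l1_sum_outside [OF that(1)] by (metis ext zero_fun_apply)
qed (use X_normed subspace_l1_sum l1_sum_component l1_sum_summable in
    \<open>auto simp: scaleR_fun_def\<close>)

lemma l1_sum_partial_le:
  assumes "z \<in> carr (l1_sum I X)" "finite F" "F \<subseteq> I"
  shows "(\<Sum>i\<in>F. nrm (X i) (z i)) \<le> nrm (l1_sum I X) z"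
  unfolding l1_sum_simps
  using assms(2,3) l1_sum_component [OF assms(1)]
  by (intro finite_sum_le_infsum l1_sum_summable [OF assms(1)]) (auto simp: normed_space_nonneg X_normed)

lemma l1_single_carr:
  assumes "i \<in> I" "x \<in> carr (X i)"
  shows "l1_single i x \<in> carr (l1_sum I X)" "nrm (l1_sum I X) (l1_single i x) = nrm (X i) x"
proof -
  have "nrm (X j) (l1_single i x j) = 0" if "j \<in> I" "j \<noteq> i" for j
    using that normed_space_nrm_0 [OF X_normed] by (simp add: l1_single_def)
  note single = infsum_single_support [OF assms(1), of "\<lambda>j. nrm (X j) (l1_single i x j)", OF this]
  show "nrm (l1_sum I X) (l1_single i x) = nrm (X i) x"
    using single(2) by (simp add: l1_single_def)
  show "l1_single i x \<in> carr (l1_sum I X)"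
    by (rule l1_sumI [OF _ _ single(1)]) (use assms X_normed normed_space_0 in \<open>auto simp: l1_single_def\<close>)
qed

lemma linear_map_l1_single:
  assumes "i \<in> I"
  shows "linear_map (X i) (l1_sum I X) (l1_single i)"
  using l1_single_carr(1) [OF assms]
  by (auto simp: linear_map_def fun_eq_iff l1_single_def scaleR_fun_def)

text \<open>The norm of the remainder is a tail of the convergent series of norms. Consequently a
  bounded linear map on the l^1 sum is determined by its restrictions to the summands.\<close>

lemma has_nsum_l1_single:
  assumes "z \<in> carr (l1_sum I X)"
  shows "has_nsum (l1_sum I X) (\<lambda>i. l1_single i (z i)) I z"
  unfolding has_nsum_def
proof
  let ?h = "\<lambda>i. nrm (X i) (z i)"
  have "nrm (l1_sum I X) (z - (\<Sum>i\<in>F. l1_single i (z i))) = infsum ?h I - sum ?h F"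
    if F: "finite F" "F \<subseteq> I" for F
  proof -
    have "nrm (l1_sum I X) (z - (\<Sum>i\<in>F. l1_single i (z i))) = infsum ?h (I - F)"
      unfolding l1_sum_simps
    proof (rule infsum_cong_neutral)
      fix i
      assume "i \<in> I - (I - F)"
      then show "nrm (X i) ((z - (\<Sum>i\<in>F. l1_single i (z i))) i) = 0"
        using F normed_space_nrm_0 [OF X_normed] by (auto simp: sum_l1_single)
    qed (use F in \<open>auto simp: sum_l1_single\<close>)
    also have "\<dots> = infsum ?h I - infsum ?h F"
      using F l1_sum_summable [OF assms] by (intro infsum_Diff) auto
    finally show ?thesis
      using F by simp
  qed
  then have "\<forall>\<^sub>F F in finite_subsets_at_top I.
      infsum ?h I - sum ?h F = nrm (l1_sum I X) (z - (\<Sum>i\<in>F. l1_single i (z i)))"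
    by (intro eventually_finite_subsets_at_top_weakI) simp
  moreover have "((\<lambda>F. infsum ?h I - sum ?h F) \<longlongrightarrow> infsum ?h I - infsum ?h I) (finite_subsets_at_top I)"
    by (intro tendsto_intros infsum_tendsto l1_sum_summable [OF assms])
  ultimately show "((\<lambda>F. nrm (l1_sum I X) (z - (\<Sum>i\<in>F. l1_single i (z i)))) \<longlongrightarrow> 0) (finite_subsets_at_top I)"
    by (auto intro: Lim_transform_eventually)
qed (rule assms)

end

text \<open>The limit is formed in each summand, which alone does not give convergence of the sum of
  the norms. That sum is therefore estimated over a finite F, where m can tend to infinity in s n -
  s m, with a bound independent of F.\<close>

lemma banach_space_l1_sum:
  assumes "\<And>i. i \<in> I \<Longrightarrow> banach_space (X i)"
  shows "banach_space (l1_sum I X)"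
  unfolding banach_space_def
proof (intro conjI allI impI)
  have X: "normed_space (X i)" if "i \<in> I" for i
    using assms [OF that] by (rule banach_space_normed)
  interpret normed_family I X
    by unfold_locales (rule X)
  show normed: "normed_space (l1_sum I X)"
    by (rule normed_space_l1_sum)
  fix s :: "nat \<Rightarrow> 'a \<Rightarrow> 'b"
  assume "range s \<subseteq> carr (l1_sum I X)"
    and cauchy: "\<forall>e>0. \<exists>N. \<forall>i\<ge>N. \<forall>j\<ge>N. nrm (l1_sum I X) (s i - s j) < e"
  then have s: "s n \<in> carr (l1_sum I X)" for n
    by auto
  have diff: "s m - s n \<in> carr (l1_sum I X)" for m n
    by (rule normed_space_diff [OF normed s s])
  have "\<exists>x\<in>carr (X i). (\<lambda>n. nrm (X i) (s n i - x)) \<longlonglongrightarrow> 0" if i: "i \<in> I" for i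
  proof -
    have le: "nrm (X i) (s m i - s n i) \<le> nrm (l1_sum I X) (s m - s n)" for m n
      using l1_sum_partial_le [OF diff, where F = "{i}"] i by simp
    have "\<forall>e>0. \<exists>N. \<forall>m\<ge>N. \<forall>n\<ge>N. nrm (X i) (s m i - s n i) < e"
    proof (intro allI impI)
      fix e :: real
      assume "e > 0"
      with cauchy obtain N where "\<forall>m\<ge>N. \<forall>n\<ge>N. nrm (l1_sum I X) (s m - s n) < e"
        by blast
      then show "\<exists>N. \<forall>m\<ge>N. \<forall>n\<ge>N. nrm (X i) (s m i - s n i) < e"
        using le by (meson le_less_trans)
    qed
    moreover have "range (\<lambda>n. s n i) \<subseteq> carr (X i)"
      using l1_sum_component [OF s i] by auto
    ultimately show ?thesis
      using assms [OF i] unfolding banach_space_def by blast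
  qed
  then obtain l where l: "\<And>i. i \<in> I \<Longrightarrow> l i \<in> carr (X i)"
    "\<And>i. i \<in> I \<Longrightarrow> (\<lambda>n. nrm (X i) (s n i - l i)) \<longlonglongrightarrow> 0"
    by metis
  define x where "x = (\<lambda>i. if i \<in> I then l i else 0)"
  have partial: "(\<Sum>i\<in>F. nrm (X i) (s n i - l i)) \<le> e"
    if F: "finite F" "F \<subseteq> I" and N: "\<And>m n. m \<ge> N \<Longrightarrow> n \<ge> N \<Longrightarrow> nrm (l1_sum I X) (s m - s n) < e"
      and n: "n \<ge> N" for F N n e
  proof (rule LIMSEQ_le_const)
    show "(\<lambda>m. e + (\<Sum>i\<in>F. nrm (X i) (s m i - l i))) \<longlonglongrightarrow> e"
      using F(2) l(2) by (intro tendsto_eq_intros tendsto_null_sum) auto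
    have "(\<Sum>i\<in>F. nrm (X i) (s n i - l i)) \<le> e + (\<Sum>i\<in>F. nrm (X i) (s m i - l i))" if "m \<ge> N" for m
    proof -
      have "(\<Sum>i\<in>F. nrm (X i) (s n i - l i)) \<le> (\<Sum>i\<in>F. nrm (X i) (s n i - s m i) + nrm (X i) (s m i - l i))"
        using F(2) X l(1) l1_sum_component [OF s]
        by (intro sum_mono normed_space_triangle_diff) auto
      also have "\<dots> = (\<Sum>i\<in>F. nrm (X i) ((s n - s m) i)) + (\<Sum>i\<in>F. nrm (X i) (s m i - l i))"
        by (simp add: sum.distrib)
      finally show ?thesis
        using l1_sum_partial_le [OF diff F, of n m] N [OF n that] by linarith
    qed
    then show "\<exists>N. \<forall>m\<ge>N. (\<Sum>i\<in>F. nrm (X i) (s n i - l i)) \<le> e + (\<Sum>i\<in>F. nrm (X i) (s m i - l i))"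
      by blast
  qed
  have nonneg: "0 \<le> nrm (X i) (s n i - l i)" if "i \<in> I" for i n
    using normed_space_nonneg [OF X normed_space_diff [OF X l1_sum_component [OF s] l(1)]] that by blast
  have bound: "(\<lambda>i. nrm (X i) (s n i - l i)) summable_on I" "(\<Sum>\<^sub>\<infinity>i\<in>I. nrm (X i) (s n i - l i)) \<le> e"
    if N: "\<And>m n. m \<ge> N \<Longrightarrow> n \<ge> N \<Longrightarrow> nrm (l1_sum I X) (s m - s n) < e"
      and n: "n \<ge> N" for N n e
  proof -
    show sum: "(\<lambda>i. nrm (X i) (s n i - l i)) summable_on I"
      using nonneg partial [OF _ _ N n]
      by (intro nonneg_bounded_partial_sums_imp_summable_on [where C = e]) auto
    show "(\<Sum>\<^sub>\<infinity>i\<in>I. nrm (X i) (s n i - l i)) \<le> e"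
      using partial [OF _ _ N n] by (intro infsum_le_finite_sums sum) auto
  qed
  obtain N where N: "\<And>m n. m \<ge> N \<Longrightarrow> n \<ge> N \<Longrightarrow> nrm (l1_sum I X) (s m - s n) < 1"
    using cauchy zero_less_one by blast
  have "s N - x \<in> carr (l1_sum I X)"
  proof (rule l1_sumI)
    have "(\<lambda>i. nrm (X i) ((s N - x) i)) summable_on I \<longleftrightarrow> (\<lambda>i. nrm (X i) (s N i - l i)) summable_on I"
      by (intro summable_on_cong) (simp add: x_def)
    then show "(\<lambda>i. nrm (X i) ((s N - x) i)) summable_on I"
      using bound(1) [OF N order_refl] by simp
  qed (use X l(1) l1_sum_component [OF s] l1_sum_outside [OF s] in \<open>auto simp: x_def normed_space_diff\<close>)
  then have "x \<in> carr (l1_sum I X)"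
    using normed_space_diff [OF normed s, of "s N - x" N] by simp
  moreover have "(\<lambda>n. nrm (l1_sum I X) (s n - x)) \<longlonglongrightarrow> 0"
  proof (rule LIMSEQ_I)
    fix r :: real
    assume "r > 0"
    then have "r / 2 > 0" by simp
    with cauchy obtain N where N: "\<And>m n. m \<ge> N \<Longrightarrow> n \<ge> N \<Longrightarrow> nrm (l1_sum I X) (s m - s n) < r / 2"
      by blast
    have "norm (nrm (l1_sum I X) (s n - x) - 0) < r" if "n \<ge> N" for n
    proof -
      have "nrm (l1_sum I X) (s n - x) = (\<Sum>\<^sub>\<infinity>i\<in>I. nrm (X i) (s n i - l i))"
        unfolding l1_sum_simps by (intro infsum_cong) (simp add: x_def)
      moreover have "0 \<le> (\<Sum>\<^sub>\<infinity>i\<in>I. nrm (X i) (s n i - l i))"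
        using nonneg by (rule infsum_nonneg)
      ultimately show ?thesis
        using bound(2) [OF N that] \<open>r > 0\<close> by simp
    qed
    then show "\<exists>N. \<forall>n\<ge>N. norm (nrm (l1_sum I X) (s n - x) - 0) < r"
      by blast
  qed
  ultimately show "\<exists>x\<in>carr (l1_sum I X). (\<lambda>n. nrm (l1_sum I X) (s n - x)) \<longlonglongrightarrow> 0"
    by blast
qed

section \<open>Tensor products of l^p_n with the l^1 sum\<close>

locale multinormed_family =
  fixes p p' :: ennreal and I :: "'i set" and X :: "'i \<Rightarrow> 'a::real_vector mnspace"
  assumes conjugate: "1 / p + 1 / p' = 1" and X_multinormed: "i \<in> I \<Longrightarrow> multinormed_space p (X i)"

sublocale multinormed_family \<subseteq> normed_family I X
  by unfold_locales (rule multinormed_normed [OF X_multinormed])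

context multinormed_family
begin

text \<open>The formula for the norm imposes no summability, and \<open>infsum\<close> is 0 on a
  divergent family. The series converges because \<open>multinormed_le_sum\<close> bounds its i-th
  term by the sum over k < n of the norms of \<open>w k i\<close>.\<close>

lemma l1_tensor:
  assumes "1 \<le> n" "w \<in> tensor_carr n (l1_sum I X)"
  shows l1_tensor_component: "i \<in> I \<Longrightarrow> (\<lambda>k. w k i) \<in> tensor_carr n (X i)"
    and l1_tensor_nonneg: "i \<in> I \<Longrightarrow> 0 \<le> tnrm (X i) n (\<lambda>k. w k i)"
    and l1_tensor_summable: "(\<lambda>i. tnrm (X i) n (\<lambda>k. w k i)) summable_on I"
proof -
  have mem: "w k \<in> carr (l1_sum I X)" for k
    using tensor_carr_mem [OF normed_space_l1_sum assms(2)] .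
  show comp: "(\<lambda>k. w k i) \<in> tensor_carr n (X i)" if "i \<in> I" for i
    using l1_sum_component [OF mem that] tensor_carr_0 [OF assms(2)] by (simp add: tensor_carr_def)
  show nonneg: "0 \<le> tnrm (X i) n (\<lambda>k. w k i)" if "i \<in> I" for i
    using normed_space_nonneg [OF multinormed_tensor [OF X_multinormed [OF that] assms(1)]] comp [OF that] by simp
  show "(\<lambda>i. tnrm (X i) n (\<lambda>k. w k i)) summable_on I"
  proof (rule summable_on_comparison_test)
    show "(\<lambda>i. \<Sum>k<n. nrm (X i) (w k i)) summable_on I"
      by (rule summable_on_finite_sum [OF l1_sum_summable [OF mem]])
  qed (use multinormed_le_sum [OF X_multinormed conjugate assms(1) comp] nonneg in auto)
qed

lemma l1_tensor_partial_le:
  assumes "1 \<le> n" "w \<in> tensor_carr n (l1_sum I X)" "finite F" "F \<subseteq> I"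
  shows "(\<Sum>i\<in>F. tnrm (X i) n (\<lambda>k. w k i)) \<le> tnrm (l1_sum I X) n w"
  unfolding l1_sum_simps using assms(3,4) l1_tensor_nonneg [OF assms(1,2)]
  by (intro finite_sum_le_infsum l1_tensor_summable [OF assms(1,2)]) auto

lemma normed_space_l1_tensor:
  assumes "1 \<le> n"
  shows "normed_space (tensor_space n (l1_sum I X))"
proof (rule normed_space_infsum [where F = "\<lambda>i. tensor_space n (X i)" and \<pi> = "\<lambda>i w k. w k i" and I = I])
  show "normed_space (tensor_space n (X i))" if "i \<in> I" for i
    by (rule multinormed_tensor [OF X_multinormed [OF that] assms])
  show "subspace (carr (tensor_space n (l1_sum I X)))"
    using subspace_tensor_carr [OF normed_space_l1_sum] by simp
  fix w
  assume "w \<in> carr (tensor_space n (l1_sum I X))"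
  then have w: "w \<in> tensor_carr n (l1_sum I X)" by simp
  show "(\<lambda>k. w k i) \<in> carr (tensor_space n (X i))" if "i \<in> I" for i
    using l1_tensor_component [OF assms w that] by simp
  show "(\<lambda>i. nrm (tensor_space n (X i)) (\<lambda>k. w k i)) summable_on I"
    using l1_tensor_summable [OF assms w] by simp
  show "w = 0" if "\<And>i. i \<in> I \<Longrightarrow> (\<lambda>k. w k i) = 0"
  proof (intro ext)
    fix k i
    show "w k i = 0 k i"
      using that [of i] l1_sum_outside [OF tensor_carr_mem [OF normed_space_l1_sum w], of i k]
      by (cases "i \<in> I") (auto simp: fun_eq_iff)
  qed
qed (auto simp: scaleR_fun_def fun_eq_iff)

text \<open>Since the inclusion of a summand is isometric at every level, restricting a map to a
  summand does not increase its multibound.\<close>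

lemma l1_single_tensor:
  assumes "1 \<le> n" "i \<in> I" "w \<in> tensor_carr n (X i)"
  shows "tensor_right (l1_single i) w \<in> tensor_carr n (l1_sum I X)"
    and "tnrm (l1_sum I X) n (tensor_right (l1_single i) w) = tnrm (X i) n w"
proof -
  show "tensor_right (l1_single i) w \<in> tensor_carr n (l1_sum I X)"
    by (rule tensor_right_carr [OF linear_map_l1_single [OF assms(2)] X_normed [OF assms(2)] assms(3)])
  have "tnrm (X j) n (\<lambda>k. tensor_right (l1_single i) w k j) = 0" if "j \<in> I" "j \<noteq> i" for j
    using normed_space_nrm_0 [OF multinormed_tensor [OF X_multinormed [OF that(1)] assms(1)]] that(2)
    by (simp add: tensor_right_def l1_single_def zero_fun_def)
  from infsum_single_support(2) [OF assms(2), of "\<lambda>j. tnrm (X j) n (\<lambda>k. tensor_right (l1_single i) w k j)", OF this]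
  show "tnrm (l1_sum I X) n (tensor_right (l1_single i) w) = tnrm (X i) n w"
    by (simp add: tensor_right_def l1_single_def)
qed

text \<open>Axioms (1) and (3) are inherited summand by summand. In (2) the functional f is not
  given as a family: it is restricted to the summands, where (2) is applied, and continuity of f
  carries the estimate from finite F to all of I.\<close>

proposition multinormed_l1_sum: "multinormed_space p (l1_sum I X)"
proof (rule multinormed_spaceI [OF conjugate])
  note normed = normed_space_l1_sum
  show "banach_space (l1_sum I X)"
    by (rule banach_space_l1_sum [OF multinormed_banach [OF X_multinormed]])
  fix n :: nat
  assume n: "1 \<le> n"
  show "normed_space (tensor_space n (l1_sum I X))"
    by (rule normed_space_l1_tensor [OF n])
  show "tnrm (l1_sum I X) n (elem_tensor a x) = nrm (ellp p n) a * nrm (l1_sum I X) x"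
    if a: "a \<in> carr (ellp p n)" and x: "x \<in> carr (l1_sum I X)" for a x
  proof -
    have "(\<lambda>k. elem_tensor a x k i) = elem_tensor a (x i)" for i
      by (simp add: elem_tensor_def scaleR_fun_def)
    then show ?thesis
      using multinormed_elem [OF X_multinormed n a l1_sum_component [OF x]]
      by (simp add: flip: infsum_cmult_right' cong: infsum_cong)
  qed
  show "\<bar>tensor_pairing n a f w\<bar> \<le> tnrm (l1_sum I X) n w"
    if w: "w \<in> tensor_carr n (l1_sum I X)" and a: "a \<in> dual_ball (ellp p n)"
      and f: "f \<in> dual_ball (l1_sum I X)" for a f w
  proof -
    have f': "linear_map (l1_sum I X) scalars f" "\<And>z. z \<in> carr (l1_sum I X) \<Longrightarrow> \<bar>f z\<bar> \<le> nrm (l1_sum I X) z"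
      using f dual_ball_iff [OF normed] by auto
    have fi: "(\<lambda>x. f (l1_single i x)) \<in> dual_ball (X i)" if "i \<in> I" for i
      using f'(2) [OF l1_single_carr(1) [OF that]] l1_single_carr(2) [OF that]
        linear_map_compose [OF linear_map_l1_single [OF that] f'(1)]
      by (simp add: dual_ball_iff [OF X_normed [OF that]])
    note w_mem = tensor_carr_mem [OF normed w]
    have "has_nsum scalars (\<lambda>i. f (l1_single i (w k i))) I (f (w k))" for k
      using f'(2) l1_single_carr(1) [OF _ l1_sum_component [OF w_mem]]
      by (intro has_nsum_linear_map [OF normed normed_space_scalars f'(1), where c = 1]
          has_nsum_l1_single [OF w_mem]) auto
    then have lim: "((\<lambda>F. \<bar>f (w k) - (\<Sum>i\<in>F. f (l1_single i (w k i)))\<bar>) \<longlongrightarrow> 0) (finite_subsets_at_top I)" for k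
      by (simp add: has_nsum_def)
    have "\<bar>tensor_pairing n a f w\<bar> - tnrm (l1_sum I X) n w \<le> 0"
    proof (rule tendsto_0_finite_subsets_bound)
      show "((\<lambda>F. \<Sum>k<n. \<bar>a (unit_vec k)\<bar> * \<bar>f (w k) - (\<Sum>i\<in>F. f (l1_single i (w k i)))\<bar>) \<longlongrightarrow> 0)
          (finite_subsets_at_top I)"
        by (intro tendsto_null_sum tendsto_mult_right_zero lim)
      fix F
      assume F: "finite F" "F \<subseteq> I"
      \<comment> \<open>This is the pairing after each \<open>w k\<close> is replaced by its part
        supported on F.\<close>
      let ?S = "\<Sum>i\<in>F. tensor_pairing n a (\<lambda>x. f (l1_single i x)) (\<lambda>k. w k i)"
      have "\<bar>?S\<bar> \<le> (\<Sum>i\<in>F. tnrm (X i) n (\<lambda>k. w k i))"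
        using F(2) by (intro order_trans [OF sum_abs] sum_mono multinormed_pairing [OF X_multinormed n]
            l1_tensor_component [OF n w] a fi) auto
      also have "\<dots> \<le> tnrm (l1_sum I X) n w"
        by (rule l1_tensor_partial_le [OF n w F])
      finally have S: "\<bar>?S\<bar> \<le> tnrm (l1_sum I X) n w" .
      have "?S = (\<Sum>k<n. a (unit_vec k) * (\<Sum>i\<in>F. f (l1_single i (w k i))))"
        unfolding tensor_pairing_def sum_distrib_left by (rule sum.swap)
      then have "tensor_pairing n a f w - ?S
          = (\<Sum>k<n. a (unit_vec k) * (f (w k) - (\<Sum>i\<in>F. f (l1_single i (w k i)))))"
        by (simp add: tensor_pairing_def right_diff_distrib sum_subtractf)
      then have "\<bar>tensor_pairing n a f w - ?S\<bar>
          \<le> (\<Sum>k<n. \<bar>a (unit_vec k)\<bar> * \<bar>f (w k) - (\<Sum>i\<in>F. f (l1_single i (w k i)))\<bar>)"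
        using sum_abs [of "\<lambda>k. a (unit_vec k) * (f (w k) - (\<Sum>i\<in>F. f (l1_single i (w k i))))" "{..<n}"]
        by (simp add: abs_mult)
      with S show "\<bar>tensor_pairing n a f w\<bar> - tnrm (l1_sum I X) n w
          \<le> (\<Sum>k<n. \<bar>a (unit_vec k)\<bar> * \<bar>f (w k) - (\<Sum>i\<in>F. f (l1_single i (w k i)))\<bar>)"
        by linarith
    qed
    then show ?thesis by simp
  qed
  fix m :: nat and T c w
  assume m: "1 \<le> m" and T: "linear_map (ellp p n) (ellp p m) T"
    and c: "0 \<le> c" "\<And>x. x \<in> carr (ellp p n) \<Longrightarrow> nrm (ellp p m) (T x) \<le> c * nrm (ellp p n) x"
    and w: "w \<in> tensor_carr n (l1_sum I X)"
  \<comment> \<open>T acts on the tuple index only and so commutes with taking the i-th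
    component.\<close>
  have comp: "(\<lambda>j. tensor_left n T w j i) = tensor_left n T (\<lambda>k. w k i)" for i
    by (simp add: fun_eq_iff tensor_left_apply sum_fun_apply scaleR_fun_def)
  have "tnrm (l1_sum I X) m (tensor_left n T w) \<le> (\<Sum>\<^sub>\<infinity>i\<in>I. c * tnrm (X i) n (\<lambda>k. w k i))"
    unfolding l1_sum_simps
  proof (intro infsum_mono summable_on_cmult_right l1_tensor_summable [OF n w])
    show "(\<lambda>i. tnrm (X i) m (\<lambda>j. tensor_left n T w j i)) summable_on I"
      by (rule l1_tensor_summable [OF m tensor_left_carr [OF normed T w]])
    show "tnrm (X i) m (\<lambda>j. tensor_left n T w j i) \<le> c * tnrm (X i) n (\<lambda>k. w k i)" if "i \<in> I" for i
      unfolding comp by (rule multinormed_left [OF X_multinormed [OF that] conjugate m n T c l1_tensor_component [OF n w that]])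
  qed
  then show "tnrm (l1_sum I X) m (tensor_left n T w) \<le> c * tnrm (l1_sum I X) n w"
    by (simp add: infsum_cmult_right')
qed

end

text \<open>Each restriction of u has multibound at most c and lifts within C = c + \<epsilon>. As C
  does not depend on i, the images of the components of z are absolutely summable, and completeness
  of Y provides their sum.\<close>

proposition one_projective_l1_sum:
  fixes p p' :: ennreal and Z :: "'i \<Rightarrow> 'z::real_vector mnspace"
  assumes "1 / p + 1 / p' = 1"
    and proj: "\<And>i. i \<in> I \<Longrightarrow> one_projective TYPE('y::real_vector) TYPE('x::real_vector) p (Z i)"
  shows "one_projective TYPE('y) TYPE('x) p (l1_sum I Z)"
  unfolding one_projective_def
proof (intro conjI allI impI)
  have mZ: "multinormed_space p (Z i)" if "i \<in> I" for i
    using proj [OF that] by (simp add: one_projective_def)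
  interpret multinormed_family p p' I Z
    by unfold_locales (fact assms(1), rule mZ)
  show mS: "multinormed_space p (l1_sum I Z)"
    by (rule multinormed_l1_sum)
  fix \<epsilon> :: real and Y :: "'y mnspace" and X :: "'x mnspace" and q u
  assume \<epsilon>: "\<epsilon> > 0" and mY: "multinormed_space p Y" and mX: "multinormed_space p X"
    and q: "multi_quotient Y X q" and u: "multibounded (l1_sum I Z) X u"
  note Y = multinormed_normed [OF mY] and X = multinormed_normed [OF mX]
    and S = multinormed_normed [OF mS]
  obtain c where c: "0 \<le> c" "multibound (l1_sum I Z) X u = ennreal c" and lin: "linear_map (l1_sum I Z) X u"
    and bound: "\<And>n w. 1 \<le> n \<Longrightarrow> w \<in> tensor_carr n (l1_sum I Z) \<Longrightarrow>
      tnrm X n (tensor_right u w) \<le> c * tnrm (l1_sum I Z) n w"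
    using multiboundedE [OF u mS mX] by blast
  have linq: "linear_map Y X q"
    using q by (simp add: multi_quotient_def)
  define C where "C = c + \<epsilon>"
  have C: "0 \<le> C"
    using c(1) \<epsilon> by (simp add: C_def)
  have "\<exists>v. linear_map (Z i) Y v \<and> multibound (Z i) Y v \<le> ennreal C \<and>
      (\<forall>z\<in>carr (Z i). q (v z) = u (l1_single i z))" if i: "i \<in> I" for i
  proof -
    let ?u = "\<lambda>z. u (l1_single i z)"
    have lin_i: "linear_map (Z i) X ?u"
      by (rule linear_map_compose [OF linear_map_l1_single [OF i] lin])
    have le: "multibound (Z i) X ?u \<le> ennreal c"
      unfolding multibound_le_iff [OF mZ [OF i] mX lin_i c(1)]
    proof (intro allI impI ballI)
      fix n w
      assume n: "1 \<le> n" and w: "w \<in> tensor_carr n (Z i)"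
      have "tensor_right ?u w = tensor_right u (tensor_right (l1_single i) w)"
        by (simp add: tensor_right_def)
      then show "tnrm X n (tensor_right ?u w) \<le> c * tnrm (Z i) n w"
        using bound [OF n l1_single_tensor(1) [OF n i w]] unfolding l1_single_tensor(2) [OF n i w] by simp
    qed
    then have "multibounded (Z i) X ?u"
      using lin_i by (auto simp: multibounded_def intro: le_less_trans)
    then obtain v where v: "linear_map (Z i) Y v" "multibound (Z i) Y v \<le> multibound (Z i) X ?u + ennreal \<epsilon>"
      "\<forall>z\<in>carr (Z i). q (v z) = ?u z"
      using proj [OF i] \<epsilon> mY mX q unfolding one_projective_def by blast
    note v(2)
    also have "multibound (Z i) X ?u + ennreal \<epsilon> \<le> ennreal c + ennreal \<epsilon>"
      by (rule add_right_mono [OF le])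
    also have "\<dots> = ennreal C"
      using c(1) \<epsilon> by (simp add: C_def)
    finally show ?thesis
      using v(1,3) by blast
  qed
  then obtain v where lin_v: "\<And>i. i \<in> I \<Longrightarrow> linear_map (Z i) Y (v i)"
    and bound_v: "\<And>i. i \<in> I \<Longrightarrow> multibound (Z i) Y (v i) \<le> ennreal C"
    and qv: "\<And>i z. i \<in> I \<Longrightarrow> z \<in> carr (Z i) \<Longrightarrow> q (v i z) = u (l1_single i z)"
    by metis
  have v_tensor: "tnrm Y n (tensor_right (v i) w) \<le> C * tnrm (Z i) n w"
    if "i \<in> I" "1 \<le> n" "w \<in> tensor_carr n (Z i)" for i n w
    using bound_v [OF that(1)] multibound_le_iff [OF mZ [OF that(1)] mY lin_v [OF that(1)] C] that(2,3)
    by blast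
  have v_nrm: "nrm Y (v i z) \<le> C * nrm (Z i) z" if "i \<in> I" "z \<in> carr (Z i)" for i z
    using that v_tensor by (intro nrm_le_multibound [OF mZ mY assms(1) lin_v]) auto
  \<comment> \<open>On the carrier the sum exists and is unique, so the choice there is linear;
    elsewhere the value is arbitrary.\<close>
  define V where "V z = (SOME s. has_nsum Y (\<lambda>i. v i (z i)) I s)" for z
  have v_mem: "v i (z i) \<in> carr Y" if "z \<in> carr (l1_sum I Z)" "i \<in> I" for z i
    using linear_map_carr [OF lin_v [OF that(2)] l1_sum_component [OF that]] .
  have V: "has_nsum Y (\<lambda>i. v i (z i)) I (V z)" if z: "z \<in> carr (l1_sum I Z)" for z
  proof -
    have "(\<lambda>i. nrm Y (v i (z i))) summable_on I"
    proof (rule summable_on_comparison_test)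
      show "(\<lambda>i. C * nrm (Z i) (z i)) summable_on I"
        by (rule summable_on_cmult_right [OF l1_sum_summable [OF z]])
    qed (use v_nrm l1_sum_component [OF z] normed_space_nonneg [OF Y v_mem [OF z]] in auto)
    from has_nsum_exists [OF multinormed_banach [OF mY] v_mem [OF z] this] show ?thesis
      unfolding V_def by (rule someI_ex)
  qed
  have V_carr: "V z \<in> carr Y" if "z \<in> carr (l1_sum I Z)" for z
    using V [OF that] by (simp add: has_nsum_def)
  have V_eqI: "V z = s" if "z \<in> carr (l1_sum I Z)" "has_nsum Y g I s" "\<And>i. i \<in> I \<Longrightarrow> g i = v i (z i)" for z g s
  proof -
    have "has_nsum Y (\<lambda>i. v i (z i)) I s"
    proof -
      have "\<forall>\<^sub>F F in finite_subsets_at_top I. nrm Y (s - sum g F) = nrm Y (s - (\<Sum>i\<in>F. v i (z i)))"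
        using that(3) by (intro eventually_finite_subsets_at_top_weakI) (simp add: subset_iff cong: sum.cong)
      with that(2) show ?thesis
        unfolding has_nsum_def by (auto intro: Lim_transform_eventually)
    qed
    then show ?thesis
      by (intro has_nsum_unique [OF Y _ V [OF that(1)]] v_mem [OF that(1)])
  qed
  have lin_V: "linear_map (l1_sum I Z) Y V"
    unfolding linear_map_def
  proof (intro conjI ballI allI)
    show "V ` carr (l1_sum I Z) \<subseteq> carr Y"
      using V_carr by blast
    show "V (z + z') = V z + V z'" if z: "z \<in> carr (l1_sum I Z)" "z' \<in> carr (l1_sum I Z)" for z z'
      using normed_space_add [OF S z] has_nsum_add [OF Y v_mem [OF z(1)] v_mem [OF z(2)] V [OF z(1)] V [OF z(2)]]
      by (rule V_eqI) (use linear_map_add [OF lin_v l1_sum_component [OF z(1)] l1_sum_component [OF z(2)]] in auto)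
    show "V (a *\<^sub>R z) = a *\<^sub>R V z" if z: "z \<in> carr (l1_sum I Z)" for a z
    proof (rule V_eqI [OF normed_space_scaleR [OF S z]])
      show "has_nsum Y (\<lambda>i. a *\<^sub>R v i (z i)) I (a *\<^sub>R V z)"
      proof (rule has_nsum_linear_map [OF Y Y _ _ v_mem [OF z] V [OF z]])
        show "linear_map Y Y ((*\<^sub>R) a)"
          by (auto simp: linear_map_def scaleR_add_right normed_space_scaleR [OF Y])
        show "nrm Y (a *\<^sub>R x) \<le> \<bar>a\<bar> * nrm Y x" if "x \<in> carr Y" for x
          using normed_space_scale [OF Y that] by simp
      qed
    qed (use linear_map_scale [OF lin_v l1_sum_component [OF z]] in \<open>simp add: scaleR_fun_def\<close>)
  qed
  have u_nrm: "nrm X (u z) \<le> c * nrm (l1_sum I Z) z" if "z \<in> carr (l1_sum I Z)" for z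
    by (rule nrm_le_multibound [OF mS mX assms(1) lin that bound [OF order_refl]])
  have q_nrm: "nrm X (q y) \<le> 1 * nrm Y y" if "y \<in> carr Y" for y
    by (rule nrm_le_multibound [OF mY mX assms(1) linq that])
      (simp add: multi_quotient_le [OF q mY mX])
  \<comment> \<open>Both sides are the unordered sum in X of the vectors u (l1_single i (z i)): q is
    applied termwise to the sum defining V z, and u to the decomposition of z.\<close>
  have "q (V z) = u z" if z: "z \<in> carr (l1_sum I Z)" for z
  proof (rule has_nsum_unique [OF X])
    have single_mem: "l1_single i (z i) \<in> carr (l1_sum I Z)" if "i \<in> I" for i
      by (rule l1_single_carr(1) [OF that l1_sum_component [OF z that]])
    show "u (l1_single i (z i)) \<in> carr X" if "i \<in> I" for i
      by (rule linear_map_carr [OF lin single_mem [OF that]])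
    show "has_nsum X (\<lambda>i. u (l1_single i (z i))) I (u z)"
      by (rule has_nsum_linear_map [OF S X lin u_nrm single_mem has_nsum_l1_single [OF z]])
    have "has_nsum X (\<lambda>i. q (v i (z i))) I (q (V z))"
      by (rule has_nsum_linear_map [OF Y X linq q_nrm v_mem [OF z] V [OF z]])
    moreover have "\<forall>\<^sub>F F in finite_subsets_at_top I.
        nrm X (q (V z) - (\<Sum>i\<in>F. q (v i (z i)))) = nrm X (q (V z) - (\<Sum>i\<in>F. u (l1_single i (z i))))"
      using qv l1_sum_component [OF z]
      by (intro eventually_finite_subsets_at_top_weakI) (simp add: subset_iff cong: sum.cong)
    ultimately show "has_nsum X (\<lambda>i. u (l1_single i (z i))) I (q (V z))"
      unfolding has_nsum_def by (auto intro: Lim_transform_eventually)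
  qed
  moreover have "multibound (l1_sum I Z) Y V \<le> ennreal C"
    unfolding multibound_le_iff [OF mS mY lin_V C]
  proof (intro allI impI ballI)
    fix n w
    assume n: "1 \<le> n" and w: "w \<in> tensor_carr n (l1_sum I Z)"
    note w_mem = tensor_carr_mem [OF S w] and nY = multinormed_tensor [OF mY n]
    note comp = l1_tensor_component [OF n w]
    note Vw = tensor_right_carr [OF lin_V S w]
    \<comment> \<open>Over a finite F the triangle inequality adds up the bounds for the summands,
      and the l^1 norm of w is the sum of exactly these. Convergence is known only for each V (w k),
      so the error is measured by \<open>multinormed_le_sum\<close>.\<close>
    have "tnrm Y n (tensor_right V w) - C * tnrm (l1_sum I Z) n w \<le> 0"
    proof (rule tendsto_0_finite_subsets_bound)
      show "((\<lambda>F. \<Sum>k<n. nrm Y (V (w k) - (\<Sum>i\<in>F. v i (w k i)))) \<longlongrightarrow> 0) (finite_subsets_at_top I)"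
        using V [OF w_mem] by (intro tendsto_null_sum) (simp add: has_nsum_def)
      fix F
      assume F: "finite F" "F \<subseteq> I"
      let ?W = "\<Sum>i\<in>F. tensor_right (v i) (\<lambda>k. w k i)"
      have vi: "tensor_right (v i) (\<lambda>k. w k i) \<in> tensor_carr n Y" if "i \<in> F" for i
        using that F(2) by (intro tensor_right_carr [OF lin_v X_normed comp]) auto
      have W: "?W \<in> tensor_carr n Y"
        by (rule subspace_sum [OF subspace_tensor_carr [OF Y] vi])
      have "tnrm Y n ?W \<le> (\<Sum>i\<in>F. tnrm Y n (tensor_right (v i) (\<lambda>k. w k i)))"
        using normed_space_sum_le [OF nY, of F "\<lambda>i. tensor_right (v i) (\<lambda>k. w k i)"] vi by simp
      also have "\<dots> \<le> (\<Sum>i\<in>F. C * tnrm (Z i) n (\<lambda>k. w k i))"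
        using F(2) by (intro sum_mono v_tensor n comp) auto
      also have "\<dots> \<le> C * tnrm (l1_sum I Z) n w"
        unfolding sum_distrib_left [symmetric]
        by (intro mult_left_mono l1_tensor_partial_le [OF n w F] C)
      finally have 1: "tnrm Y n ?W \<le> C * tnrm (l1_sum I Z) n w" .
      have diff: "tensor_right V w - ?W \<in> tensor_carr n Y"
        by (rule subspace_diff [OF subspace_tensor_carr [OF Y] Vw W])
      have 2: "tnrm Y n (tensor_right V w - ?W) \<le> (\<Sum>k<n. nrm Y (V (w k) - (\<Sum>i\<in>F. v i (w k i))))"
        using multinormed_le_sum [OF mY assms(1) n diff] by (simp add: tensor_right_def sum_fun_apply)
      have "tnrm Y n (tensor_right V w) \<le> tnrm Y n (tensor_right V w - ?W) + tnrm Y n ?W"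
        using normed_space_triangle [OF nY, of "tensor_right V w - ?W" ?W] diff W by simp
      with 1 2 show "tnrm Y n (tensor_right V w) - C * tnrm (l1_sum I Z) n w
          \<le> (\<Sum>k<n. nrm Y (V (w k) - (\<Sum>i\<in>F. v i (w k i))))"
        by linarith
    qed
    then show "tnrm Y n (tensor_right V w) \<le> C * tnrm (l1_sum I Z) n w"
      by simp
  qed
  ultimately show "\<exists>v. linear_map (l1_sum I Z) Y v \<and>
      multibound (l1_sum I Z) Y v \<le> multibound (l1_sum I Z) X u + ennreal \<epsilon> \<and>
      (\<forall>z\<in>carr (l1_sum I Z). q (v z) = u z)"
    using lin_V c \<epsilon> by (intro exI [of _ V]) (simp add: C_def ennreal_plus)
qed

theorem corollary4p3:
  fixes p p' :: ennreal and I :: "'i set" and N :: "'i \<Rightarrow> nat"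
  assumes "1 \<le> p" and "1 / p + 1 / p' = 1"
    and "\<And>i. i \<in> I \<Longrightarrow> 1 \<le> N i"
  shows "one_projective TYPE('y::real_vector) TYPE('x::real_vector) p
           (l1_sum I (\<lambda>i. min_mn p (ellp p' (N i))))"
  using assms by (intro one_projective_l1_sum one_projective_min_mn_ellp)

end
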